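(* Consider Poisson Boolean percolation in $\mathbb{R}^d$, for some $d\ge2$, with radius distribution $\mu$ a probability distribution on $\mathbb{R}_+$, and assume that $\int_0^\infty r^d\,\mu(\mathrm{d}r)<\infty$. Then $$\lambda_c^\star\in(0,\infty).$$
   Context: Poisson Boolean percolation in $\mathbb{R}^d$ with intensity $\lambda\ge 0$ and radius distribution $\mu$ (a probability distribution on $\mathbb{R}_+$): under the probability measure $\mathbb{P}_\lambda$, $\omega$ is a Poisson point process on $\mathbb{R}^d\times\mathbb{R}_+$ with intensity $\lambda\,\mathrm{d}x\,\mu(\mathrm{d}z)$; that is, at each point of a Poisson point process of intensity $\lambda$ in $\mathbb{R}^d$ one centres a ball whose radius is sampled independently from $\mu$. Let $B(x,z)$ denote the Euclidean ball in $\mathbb{R}^d$ with centre $x$ and radius $z$. The occupied set is $\mathcal{O}=\bigcup_{(x,z)\in\omega}B(x,z)$ and the vacant set is $\mathcal{V}=\mathbb{R}^d\setminus\mathcal{O}$. Write $0\stackrel{\mathcal{V}}{\longleftrightarrow}\infty$ if the connected component in $\mathcal{V}$ of the origin is unbounded. The threshold for the vacant set is $$\lambda_c^\star:=\sup\big\{\lambda\ge0:\mathbb{P}_\lambda\big[0\stackrel{\mathcal{V}}{\longleftrightarrow}\infty\big]>0\big\}.$$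
   Formalization: The radius distribution μ is assumed different from the Dirac mass at 0; for μ = δ_0 the occupied set is countable, the vacant set percolates at every intensity, and λ_c* = ∞, so the claim fails there. *)

theory Defs
  imports "HOL-Probability.Probability"
begin

definition num_points :: "'b set \<Rightarrow> 'b set \<Rightarrow> ennreal" where
  "num_points \<xi> A = emeasure (count_space UNIV) (\<xi> \<inter> A)"

(* A point process is represented by its random set of points. This loses nothing for the diffuse
   intensity measures considered below, whose Poisson processes have almost surely no multiple
   points. The Poisson law is written out because poisson_pmf does not cover the rate 0.
   For a sigma-finite N, the clauses below force infinitely many points almost surely in a set of
   infinite N-measure. *)
definition poisson_point_process :: "'w measure \<Rightarrow> ('w \<Rightarrow> 'b set) \<Rightarrow> 'b measure \<Rightarrow> bool" where
  "poisson_point_process M \<omega> N \<longleftrightarrow>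
     prob_space M \<and>
     (\<forall>A\<in>sets N. (\<lambda>w. num_points (\<omega> w) A) \<in> borel_measurable M) \<and>
     (\<forall>A\<in>sets N. emeasure N A < \<infinity> \<longrightarrow>
        (\<forall>k::nat. \<P>(w in M. num_points (\<omega> w) A = of_nat k) =
           measure N A ^ k / fact k * exp (- measure N A))) \<and>
     (\<forall>A :: nat \<Rightarrow> 'b set. range A \<subseteq> sets N \<and> disjoint_family A \<longrightarrow>
        prob_space.indep_vars M (\<lambda>_. borel) (\<lambda>i w. num_points (\<omega> w) (A i)) UNIV)"

definition boolean_intensity ::
    "real \<Rightarrow> real measure \<Rightarrow> ('a::euclidean_space \<times> real) measure" where
  "boolean_intensity l \<mu> = scale_measure (ennreal l) (lborel \<Otimes>\<^sub>M \<mu>)"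

definition occupied_set :: "('a::euclidean_space \<times> real) set \<Rightarrow> 'a set" where
  "occupied_set \<xi> = (\<Union>(x, z)\<in>\<xi>. cball x z)"

definition vacant_set :: "('a::euclidean_space \<times> real) set \<Rightarrow> 'a set" where
  "vacant_set \<xi> = - occupied_set \<xi>"

(* connected_component_set S 0 is empty, hence bounded, if 0 is not in S. *)
definition vacant_to_infinity :: "('a::euclidean_space \<times> real) set \<Rightarrow> bool" where
  "vacant_to_infinity \<xi> \<longleftrightarrow> \<not> bounded (connected_component_set (vacant_set \<xi>) 0)"

(* The supremum is taken in the extended reals, so that it is infinite if the set is unbounded.
   The measure is completed because percolation of the vacant set is a measurable event only up to
   the null event on which infinitely many balls meet a bounded region; without completion, measure
   could return its default value 0 on it. *)
definition vacant_threshold ::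
    "(real \<Rightarrow> 'w measure) \<Rightarrow> ('w \<Rightarrow> ('a::euclidean_space \<times> real) set) \<Rightarrow> ereal" where
  "vacant_threshold P \<omega> =
     Sup {ereal l | l. 0 \<le> l \<and> \<P>(w in completion (P l). vacant_to_infinity (\<omega> w)) > 0}"

end

theory Submission
  imports Defs
begin

text \<open>
  Both inequalities come from one estimate across scales for independent random balls. Say that
  such a family crosses at the point \<open>y\<close> and scale \<open>R\<close> if a chain of overlapping balls, all of radius
  at most \<open>R / 2\<close>, leads from within distance \<open>R\<close> of \<open>y\<close> to distance \<open>2 R\<close>. A crossing at scale \<open>9 R\<close>
  that meets no ball of radius above \<open>R / 2\<close> contains two crossings at scale \<open>R\<close> around points that
  are more than \<open>6 R\<close> apart (\<open>crossing_split\<close>). These two depend on disjoint sets of balls, so they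
  are independent, and the crossing probabilities satisfy \<open>p (9 R) \<le> C * p R ^ 2 + s\<close>, where \<open>s\<close>
  bounds the expected number of balls near the point with radius between \<open>R / 2\<close> and \<open>9 R / 2\<close>. A
  radius is charged at a single scale, with weight \<open>R ^ d\<close>, so a finite moment of order \<open>d\<close> makes the
  errors \<open>s\<close> summable over the scales. If their sum is small, so is the sum of all crossing
  probabilities (\<open>prob_crossing_le\<close>, \<open>scale_bound_summable\<close>).

  \<^emph>\<open>The threshold is positive.\<close> Suppose that the vacant component of the origin is bounded. Its
  frontier is occupied, and one connected component \<open>C\<close> of the frontier already separates the origin
  from infinity. For \<open>p\<close> in \<open>C\<close>, the set \<open>C\<close> cannot be contained in the ball around \<open>p\<close> of radius
  \<open>norm p / 2\<close>, since the complement of a ball is connected in dimension at least two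
  (\<open>separating_continuum\<close>). So occupied balls link \<open>p\<close> to a point at distance comparable to
  \<open>norm p\<close>. If every ball is small compared with the distance of its centre from the origin, this is a
  crossing at the scale of \<open>norm p\<close>. The balls \<open>(x, z)\<close> that are not small in this sense have
  \<open>norm x\<close> at most a constant times \<open>z\<close>; their expected number is at most the intensity times a
  moment of order \<open>d\<close>. Removing them once and for all is essential: a large ball obstructs all smaller
  scales, and a union bound that charges it at each of them would need a logarithmic factor more than
  the moment provides. In total the origin fails to percolate with probability of the order of the
  intensity (\<open>vacant_percolation_probable\<close>). The argument uses no planar duality and works in every
  dimension \<open>d \<ge> 2\<close> directly.

  \<^emph>\<open>The threshold is finite.\<close> A cube of a fine lattice is covered as soon as it contains the centre
  of a ball of radius at least \<open>\<epsilon>\<close>. The other cubes are independent of each other and their density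
  tends to zero as the intensity grows. Balls of constant radius around them cover the vacant set, so
  an unbounded vacant component causes crossings at all scales, whose probabilities tend to zero
  (\<open>vacant_percolation_null\<close>).

  To apply the estimate to a Poisson process, centres are rounded to a lattice and radii are rounded
  up to a discrete set. The numbers of points in the countably many cells so obtained are independent,
  and crossings at a given place and scale depend on finitely many cells.
\<close>

section \<open>Chains of balls\<close>

text \<open>
  A pair \<open>(c, r)\<close> stands for the ball with centre \<open>c\<close> and radius \<open>r\<close>. The relation is restricted to \<open>S\<close>
  on both sides so that its reflexive transitive closure describes chains that stay in \<open>S\<close>.
\<close>
definition links :: "('a::real_normed_vector \<times> real) set \<Rightarrow> (('a \<times> real) \<times> ('a \<times> real)) set" where
  "links S = {(i, j). i \<in> S \<and> j \<in> S \<and> dist (fst i) (fst j) \<le> snd i + snd j}"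

text \<open>
  The balls that a crossing at \<open>y\<close> and scale \<open>R\<close> may use. Their radii are at most \<open>R / 2\<close>, so a chain
  moves by at most \<open>R\<close> per step and reaches distance \<open>2 R\<close> before its centres exceed distance \<open>3 R\<close>:
  whether there is a crossing is decided within a bounded region.
\<close>
definition near :: "('a::real_normed_vector \<times> real) set \<Rightarrow> 'a \<Rightarrow> real \<Rightarrow> ('a \<times> real) set" where
  "near S y R = {i \<in> S. dist (fst i) y \<le> 3 * R \<and> snd i \<le> R / 2}"

definition crossing :: "('a::real_normed_vector \<times> real) set \<Rightarrow> 'a \<Rightarrow> real \<Rightarrow> bool" where
  "crossing S y R \<longleftrightarrow> (\<exists>i j. i \<in> near S y R \<and> (i, j) \<in> (links (near S y R))\<^sup>* \<and>
     dist (fst i) y \<le> R \<and> 2 * R \<le> dist (fst j) y)"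

lemma links_mono: "S \<subseteq> T \<Longrightarrow> links S \<subseteq> links T"
  by (auto simp: links_def)

lemma links_sym: "(i, j) \<in> (links S)\<^sup>* \<Longrightarrow> (j, i) \<in> (links S)\<^sup>*"
proof -
  have "sym (links S)"
    by (auto simp: sym_def links_def dist_commute add.commute)
  then show "(i, j) \<in> (links S)\<^sup>* \<Longrightarrow> (j, i) \<in> (links S)\<^sup>*"
    by (meson sym_rtrancl symD)
qed

lemma links_rtrancl_in: "(i, j) \<in> (links S)\<^sup>* \<Longrightarrow> i \<in> S \<Longrightarrow> j \<in> S"
  by (induction rule: rtrancl_induct) (auto simp: links_def)

text \<open>
  The balls that can be reached from \<open>i\<close> and those that cannot have disjoint open unions, and together
  they cover \<open>C\<close>, so connectedness of \<open>C\<close> leaves no ball meeting \<open>C\<close> unreached.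
\<close>
lemma chain_of_connected:
  assumes C: "connected C" "C \<subseteq> (\<Union>k\<in>S. ball (fst k) (snd k))"
    and "p \<in> C" "q \<in> C"
    and i: "i \<in> S" "p \<in> ball (fst i) (snd i)" and j: "j \<in> S" "q \<in> ball (fst j) (snd j)"
  shows "(i, j) \<in> (links S)\<^sup>*"
proof (rule ccontr)
  assume n: "(i, j) \<notin> (links S)\<^sup>*"
  define A where "A = (\<Union>k\<in>{k\<in>S. (i, k) \<in> (links S)\<^sup>*}. ball (fst k) (snd k))"
  define B where "B = (\<Union>k\<in>{k\<in>S. (i, k) \<notin> (links S)\<^sup>*}. ball (fst k) (snd k))"
  have "open A" "open B" by (auto simp: A_def B_def)
  moreover have "C \<subseteq> A \<union> B" using C(2) by (auto simp: A_def B_def)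
  moreover have "A \<inter> B \<inter> C = {}"
  proof (rule ccontr)
    assume "A \<inter> B \<inter> C \<noteq> {}"
    then obtain x k l where x: "k \<in> S" "(i, k) \<in> (links S)\<^sup>*" "x \<in> ball (fst k) (snd k)"
      "l \<in> S" "(i, l) \<notin> (links S)\<^sup>*" "x \<in> ball (fst l) (snd l)"
      by (auto simp: A_def B_def)
    have "dist (fst k) (fst l) \<le> dist (fst k) x + dist (fst l) x" by (rule dist_triangle2)
    then have "(k, l) \<in> links S" using x by (auto simp: links_def)
    with x show False by (meson rtrancl.rtrancl_into_rtrancl)
  qed
  moreover have "p \<in> A" using i unfolding A_def by blast
  then have "A \<inter> C \<noteq> {}" using \<open>p \<in> C\<close> by blast
  moreover have "q \<in> B" using j n unfolding B_def by blast
  then have "B \<inter> C \<noteq> {}" using \<open>q \<in> C\<close> by blast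
  ultimately show False using connectedD[OF C(1)] by blast
qed

text \<open>
  The link from \<open>k\<close> to \<open>l\<close> is the first step of the chain out of \<open>T\<close>.
\<close>
lemma chain_exit:
  assumes "(i, j) \<in> (links S)\<^sup>*" "i \<in> T" "j \<notin> T"
  obtains k l where "(i, k) \<in> (links (S \<inter> T))\<^sup>*" "k \<in> T" "l \<notin> T" "(k, l) \<in> links S"
proof -
  have "(i, j) \<in> (links (S \<inter> T))\<^sup>* \<and> j \<in> T \<or>
    (\<exists>k l. (i, k) \<in> (links (S \<inter> T))\<^sup>* \<and> k \<in> T \<and> l \<notin> T \<and> (k, l) \<in> links S)"
    using assms(1)
  proof (induction rule: rtrancl_induct)
    case base
    then show ?case using assms by auto
  next
    case (step k l)
    show ?case
    proof (cases "(i, k) \<in> (links (S \<inter> T))\<^sup>* \<and> k \<in> T")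
      case True
      show ?thesis
      proof (cases "l \<in> T")
        case l: True
        then have "(k, l) \<in> links (S \<inter> T)" using True step by (auto simp: links_def)
        then show ?thesis using True l by (meson rtrancl.rtrancl_into_rtrancl)
      qed (use True step in blast)
    qed (use step in blast)
  qed
  then show thesis using assms that by blast
qed

text \<open>
  Following a long chain until its centres first get to distance \<open>2 R\<close> from \<open>y\<close> yields a crossing. The
  bounds on radii are needed for the balls of that initial part only, and a bound for the last
  one may use its link to a ball that is still inside. In this form the lemma applies to chains that
  continue to regions with very large balls.
\<close>
lemma crossing_of_chain:
  assumes "(i, j) \<in> (links S)\<^sup>*" "i \<in> S" "0 < R" "dist (fst i) y \<le> R" "2 * R \<le> dist (fst j) y"
    and inside: "\<And>k. k \<in> S \<Longrightarrow> dist (fst k) y < 2 * R \<Longrightarrow> snd k \<le> R / 2"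
    and exit: "\<And>k l. (k, l) \<in> links S \<Longrightarrow> dist (fst k) y < 2 * R \<Longrightarrow> snd k \<le> R / 2 \<Longrightarrow> snd l \<le> R / 2"
  shows "crossing S y R"
proof -
  let ?T = "{k. dist (fst k) y < 2 * R}"
  obtain k l where kl: "(i, k) \<in> (links (S \<inter> ?T))\<^sup>*" "k \<in> ?T" "l \<notin> ?T" "(k, l) \<in> links S"
    by (rule chain_exit[OF assms(1), of ?T]) (use assms in auto)
  have k: "k \<in> S" "l \<in> S" "dist (fst k) (fst l) \<le> snd k + snd l" using kl by (auto simp: links_def)
  have l: "snd k \<le> R / 2" "snd l \<le> R / 2" using inside[OF k(1)] exit[OF kl(4)] kl by auto
  have "dist (fst l) y \<le> dist (fst k) (fst l) + dist (fst k) y" by (rule dist_triangle3)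
  then have "dist (fst l) y \<le> 3 * R" using k l kl by auto
  then have ln: "l \<in> near S y R" using k l by (auto simp: near_def)
  have sub: "S \<inter> ?T \<subseteq> near S y R" using inside \<open>0 < R\<close> by (auto simp: near_def) 
  then have "(k, l) \<in> links (near S y R)" using k kl ln by (auto simp: links_def)
  moreover have "(i, k) \<in> (links (near S y R))\<^sup>*"
    using kl(1) rtrancl_mono[OF links_mono[OF sub]] by blast
  ultimately have "(i, l) \<in> (links (near S y R))\<^sup>*" by auto
  moreover have "i \<in> near S y R" using sub assms by auto
  ultimately show ?thesis
    using kl(3) assms(4) unfolding crossing_def by (intro exI[of _ i] exI[of _ l]) auto
qed

text \<open>
  The two ends of a crossing at scale \<open>9 R\<close> are at least \<open>9 R\<close> apart. Each end is within \<open>R\<close> of a point of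
  a fixed finite net, rescaled by \<open>R\<close>, and the chain between the ends leaves the ball of radius \<open>2 R\<close>
  around each of these net points. The net points are more than \<open>6 R\<close> apart, which makes the regions
  of radius \<open>3 R\<close> that decide the two crossings disjoint. Net points lose at most \<open>2 R\<close> of the distance
  between the ends, so \<open>9\<close> is the smallest integer ratio between scales that leaves more than \<open>6 R\<close>.
\<close>
lemma crossing_split:
  assumes F: "cball 0 27 \<subseteq> (\<Union>f\<in>F. cball f 1)" and R: "0 < R"
    and cr: "crossing S x (9 * R)"
    and small: "\<And>i. i \<in> near S x (9 * R) \<Longrightarrow> snd i \<le> R / 2"
  shows "\<exists>f\<in>F. \<exists>g\<in>F. 6 < dist f g \<and> crossing S (x + R *\<^sub>R f) R \<and> crossing S (x + R *\<^sub>R g) R"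
proof -
  let ?N = "near S x (9 * R)"
  obtain i j where i: "i \<in> ?N" "(i, j) \<in> (links ?N)\<^sup>*"
    and d: "dist (fst i) x \<le> 9 * R" "18 * R \<le> dist (fst j) x"
    using cr by (auto simp: crossing_def)
  have j: "j \<in> ?N" using links_rtrancl_in i by blast
  have net: "\<exists>f\<in>F. dist (fst k) (x + R *\<^sub>R f) \<le> R" if "k \<in> ?N" for k
  proof -
    have "norm (fst k - x) \<le> 27 * R" using that by (auto simp: near_def dist_norm)
    moreover have "norm ((1 / R) *\<^sub>R (fst k - x)) = norm (fst k - x) / R"
      using R by (simp only: norm_scaleR) simp
    ultimately have "(1 / R) *\<^sub>R (fst k - x) \<in> cball 0 27" using R by (simp add: pos_divide_le_eq)
    then obtain f where "f \<in> F" "norm (f - (1 / R) *\<^sub>R (fst k - x)) \<le> 1"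
      using F by (force simp: dist_norm)
    moreover have "fst k - (x + R *\<^sub>R f) = - (R *\<^sub>R (f - (1 / R) *\<^sub>R (fst k - x)))"
      using R by (simp add: algebra_simps)
    then have "dist (fst k) (x + R *\<^sub>R f) = R * norm (f - (1 / R) *\<^sub>R (fst k - x))"
      using R by (simp add: dist_norm)
    ultimately show ?thesis using R by (metis mult_left_le less_imp_le)
  qed
  obtain f g where f: "f \<in> F" "dist (fst i) (x + R *\<^sub>R f) \<le> R" and g: "g \<in> F" "dist (fst j) (x + R *\<^sub>R g) \<le> R"
    using net i j by meson
  have ij: "9 * R \<le> dist (fst i) (fst j)" using dist_triangle3[of "fst j" x "fst i"] d by (simp add: dist_commute)
  have "dist (fst i) (fst j) \<le> dist (fst i) (x + R *\<^sub>R f) + dist (x + R *\<^sub>R f) (fst j)"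
    by (rule dist_triangle)
  then have f': "2 * R \<le> dist (fst j) (x + R *\<^sub>R f)" using f ij R by (simp add: dist_commute)
  have "dist (fst i) (fst j) \<le> dist (fst i) (x + R *\<^sub>R g) + dist (x + R *\<^sub>R g) (fst j)"
    by (rule dist_triangle)
  then have g': "2 * R \<le> dist (fst i) (x + R *\<^sub>R g)" using g ij R by (simp add: dist_commute)
  have "dist (x + R *\<^sub>R f) (fst j) \<le> dist (x + R *\<^sub>R f) (x + R *\<^sub>R g) + dist (x + R *\<^sub>R g) (fst j)"
    by (rule dist_triangle)
  moreover have "dist (fst i) (fst j) \<le> dist (fst i) (x + R *\<^sub>R f) + dist (x + R *\<^sub>R f) (fst j)"
    by (rule dist_triangle)
  moreover have "dist (x + R *\<^sub>R f) (x + R *\<^sub>R g) = R * dist f g"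
    using R by (simp add: dist_norm flip: scaleR_diff_right)
  ultimately have "7 * R \<le> R * dist f g" using f g ij by (simp add: dist_commute)
  then have fg: "6 < dist f g" using R by simp
  have mono: "crossing S y R" if "crossing ?N y R" for y
  proof -
    have "near ?N y R \<subseteq> near S y R" by (auto simp: near_def)
    then show ?thesis using that rtrancl_mono[OF links_mono] unfolding crossing_def by blast
  qed
  have sm: "snd k \<le> R / 2" "snd l \<le> R / 2" if "(k, l) \<in> links ?N" for k l
    using that small by (auto simp: links_def)
  have "crossing ?N (x + R *\<^sub>R f) R"
    by (rule crossing_of_chain[OF i(2) i(1) R f(2) f']) (use small sm in auto)
  moreover have "crossing ?N (x + R *\<^sub>R g) R"
    by (rule crossing_of_chain[OF links_sym[OF i(2)] j R g(2) g']) (use small sm in auto)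
  ultimately show ?thesis using f g fg mono by blast
qed

lemma finite_unit_net:
  obtains F :: "'a::euclidean_space set" where "finite F" "cball 0 r \<subseteq> (\<Union>f\<in>F. cball f 1)"
proof -
  have "compact (cball (0::'a) r)" by simp
  then obtain F where "finite F" "cball (0::'a) r \<subseteq> (\<Union>f\<in>F. ball f 1)"
    by (rule compactE_image[where C = UNIV and f = "\<lambda>f. ball f 1"])
      (use centre_in_ball[of _ "1::real"] in auto, metis dist_self zero_less_one)
  then show thesis by (intro that[of F]) (use ball_subset_cball in blast)+
qed

section \<open>Continua around a bounded component\<close>

lemma closed_Union_locally_finite_cballs:
  fixes S :: "('a::euclidean_space \<times> real) set"
  assumes "\<And>r. finite {i \<in> S. cball (fst i) (f i) \<inter> cball 0 r \<noteq> {}}"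
  shows "closed (\<Union>i\<in>S. cball (fst i) (f i))"
proof -
  let ?A = "\<Union>i\<in>S. cball (fst i) (f i)"
  have "\<exists>T. open T \<and> x \<in> T \<and> T \<subseteq> - ?A" if "x \<notin> ?A" for x
  proof -
    let ?J = "{i \<in> S. cball (fst i) (f i) \<inter> cball 0 (norm x + 1) \<noteq> {}}"
    let ?T = "- (\<Union>i\<in>?J. cball (fst i) (f i)) \<inter> ball 0 (norm x + 1)"
    have "open ?T"
      using assms by (intro open_Int open_Compl closed_UN) auto
    moreover have "x \<in> ?T" using that by auto
    moreover have "?T \<subseteq> - ?A"
    proof
      fix y assume y: "y \<in> ?T"
      then have "y \<in> cball 0 (norm x + 1)" by auto
      then show "y \<in> - ?A" using y by blast
    qed
    ultimately show ?thesis by blast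
  qed
  then have "open (- ?A)" by (subst open_subopen) auto
  then show ?thesis by (simp add: closed_def)
qed

text \<open>
  Selects the scale \<open>9 ^ k\<close> at which a continuum at distance \<open>s\<close> from the origin is detected.
\<close>
lemma power_scale:
  assumes "8 \<le> (s::real)"
  obtains k :: nat where "8 * 9 ^ k \<le> s" "s \<le> 72 * 9 ^ k"
proof -
  obtain m :: nat where m: "s < 8 * 9 ^ m"
    using real_arch_pow[of 9 "s / 8"] by (auto simp: field_simps)
  define n where "n = (LEAST m. s < 8 * 9 ^ m)"
  have n: "s < 8 * 9 ^ n" unfolding n_def by (rule LeastI[of "\<lambda>m. s < 8 * 9 ^ m", OF m])
  then have "n \<noteq> 0" using assms by (intro notI) simp
  then obtain k where k: "n = Suc k" by (cases n) auto
  then have "\<not> s < 8 * 9 ^ k" unfolding n_def by (metis lessI not_less_Least)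
  then show thesis using n k by (intro that[of k]) auto
qed

text \<open>
  The key topological fact, which replaces circuits and planar duality. The frontier of the bounded
  component separates \<open>0\<close> from a far point \<open>b\<close>, and by a theorem on separation in Euclidean space
  a single connected component \<open>C\<close> of the frontier does so. A ball around a point \<open>p\<close> of \<open>C\<close> that
  contains \<open>C\<close> but neither \<open>0\<close> nor \<open>b\<close> would have a connected complement joining \<open>0\<close> to \<open>b\<close>.
\<close>
lemma separating_continuum:
  fixes V :: "'a::euclidean_space set"
  assumes dim: "2 \<le> DIM('a)" and "open V" "0 \<in> V"
    and bd: "bounded (connected_component_set V 0)"
  obtains C p q where "connected C" "C \<inter> V = {}" "p \<in> C" "q \<in> C" "norm p < 2 * dist p q"
proof -
  define U where "U = connected_component_set V 0"
  have U: "0 \<in> U" "open U" using assms by (auto simp: U_def open_connected_component)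
  have "U \<in> components (- (- V))" using \<open>0 \<in> V\<close> by (auto simp: U_def componentsI)
  then have fV: "frontier U \<subseteq> - V"
    by (rule frontier_of_components_closed_complement[rotated]) (use \<open>open V\<close> in \<open>simp add: closed_Compl\<close>)
  have "bounded (closure U)" using bd by (simp add: U_def bounded_closure)
  then obtain r where r: "0 < r" "\<And>x. x \<in> closure U \<Longrightarrow> norm x \<le> r"
    by (auto simp: bounded_pos)
  obtain b :: 'a where b: "norm b = 2 * r" using r by (metis less_imp_le mult_pos_pos vector_choose_size zero_less_numeral)
  have "\<not> connected_component (- frontier U) 0 b"
  proof
    assume "connected_component (- frontier U) 0 b"
    then obtain T where T: "connected T" "T \<subseteq> - frontier U" "0 \<in> T" "b \<in> T"
      by (auto simp: connected_component_def)
    have "b \<notin> U" using r b closure_subset[of U] by force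
    then have "T \<inter> frontier U \<noteq> {}" using T U by (intro connected_Int_frontier) auto
    then show False using T by auto
  qed
  then obtain C where C: "C \<in> components (frontier U)" "\<not> connected_component (- C) 0 b"
    using separation_by_component_closed_pointwise[OF frontier_closed] by blast
  have "connected C" "C \<noteq> {}" using C in_components_connected in_components_nonempty by blast+
  have CV: "C \<inter> V = {}" using C in_components_subset fV by blast
  obtain p where p: "p \<in> C" using \<open>C \<noteq> {}\<close> by blast
  have p0: "norm p > 0" using p CV \<open>0 \<in> V\<close> by auto
  have pr: "norm p \<le> r" using p r C in_components_subset[OF C(1)] by (auto simp: frontier_def)
  have "\<exists>q\<in>C. norm p < 2 * dist p q"
  proof (rule ccontr)
    assume "\<not> ?thesis"
    then have sub: "C \<subseteq> cball p (norm p / 2)" by (force simp: not_less)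
    let ?D = "- cball p (norm p / 2)"
    have "connected ?D"
      using dim by (intro connected_complement_bounded_convex) auto
    moreover have "0 \<in> ?D" using p0 by auto
    moreover have "b \<in> ?D"
    proof -
      have "norm b - norm p \<le> dist p b" by (metis dist_commute dist_norm norm_triangle_ineq2)
      then show ?thesis using b pr r(1) by (simp add: not_le)
    qed
    ultimately have "connected_component (- C) 0 b"
      using sub unfolding connected_component_def by (intro exI[of _ ?D]) auto
    then show False using C by blast
  qed
  then obtain q where "q \<in> C" "norm p < 2 * dist p q" by blast
  with p CV \<open>connected C\<close> show thesis by (intro that[of C p q]) auto
qed

text \<open>
  The covering balls have radius \<open>snd i - 1\<close> while chains use the larger radius \<open>snd i\<close>: the closed
  smaller balls have a closed union, and the open larger balls cover a continuum in it, as
  \<open>chain_of_connected\<close> requires.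
\<close>
lemma crossing_of_bounded_vacant_component:
  fixes S :: "('a::euclidean_space \<times> real) set"
  assumes dim: "2 \<le> DIM('a)"
    and F: "cball 0 144 \<subseteq> (\<Union>f\<in>F. cball f 1)"
    and S: "\<And>i. i \<in> S \<Longrightarrow> 1 \<le> snd i \<and> 1000 * snd i < norm (fst i)"
    and fin: "\<And>r. finite {i \<in> S. norm (fst i) \<le> r}"
    and bd: "bounded (connected_component_set (- (\<Union>i\<in>S. cball (fst i) (snd i - 1))) 0)"
  shows "\<exists>k::nat. \<exists>f\<in>F. crossing S (9 ^ k *\<^sub>R f) (9 ^ k)"
proof -
  let ?O = "\<Union>i\<in>S. cball (fst i) (snd i - 1)"
  have "closed ?O"
  proof (rule closed_Union_locally_finite_cballs)
    fix r
    have "norm (fst i) \<le> 2 * r" if i: "i \<in> S" and x: "x \<in> cball (fst i) (snd i - 1)" "norm x \<le> r" for i x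
      using S[OF i] x norm_triangle_ineq2[of "fst i" x] by (simp add: dist_norm) 
    then have "{i \<in> S. cball (fst i) (snd i - 1) \<inter> cball 0 r \<noteq> {}} \<subseteq> {i \<in> S. norm (fst i) \<le> 2 * r}"
      by fastforce
    then show "finite {i \<in> S. cball (fst i) (snd i - 1) \<inter> cball 0 r \<noteq> {}}"
      using fin finite_subset by blast
  qed
  moreover have "0 \<notin> ?O" using S by force
  ultimately obtain C p q where C: "connected C" "C \<subseteq> ?O" "p \<in> C" "q \<in> C" and pq: "norm p < 2 * dist p q"
    using separating_continuum[OF dim _ _ bd] by (metis (no_types, lifting) ComplI disjoint_eq_subset_Compl double_complement open_Compl)
  obtain i where i: "i \<in> S" "dist (fst i) p \<le> snd i - 1" using C by auto
  obtain j where j: "j \<in> S" "dist (fst j) q \<le> snd j - 1" using C by auto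
  let ?s = "norm p"
  have Si: "1 \<le> snd i" "1000 * snd i < norm (fst i)" using S[OF i(1)] by auto
  have ip: "norm (fst i) \<le> ?s + snd i" 
    using norm_triangle_ineq2[of "fst i" p] i by (simp add: dist_norm)
  \<comment> \<open>the bound on radii forces \<open>norm p \<ge> 8\<close>: a ball of radius at least 1 has its centre beyond 1000\<close>
  obtain k :: nat where k: "8 * 9 ^ k \<le> ?s" "?s \<le> 72 * 9 ^ k"
    using power_scale[of ?s] Si ip by auto
  define R :: real where "R = 9 ^ k"
  have R: "0 < R" "8 * R \<le> ?s" "?s \<le> 72 * R" using k by (auto simp: R_def)
  have ib: "norm (fst i) \<le> 144 * R" using R Si ip by simp
  have "norm ((1 / R) *\<^sub>R fst i) = norm (fst i) / R" using R by simp
  then have "(1 / R) *\<^sub>R fst i \<in> cball 0 144" using R ib by (simp add: pos_divide_le_eq)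
  then obtain f where f: "f \<in> F" "norm (f - (1 / R) *\<^sub>R fst i) \<le> 1"
    using F by (force simp: dist_norm)
  let ?y = "R *\<^sub>R f"
  have eq: "?y - fst i = R *\<^sub>R (f - (1 / R) *\<^sub>R fst i)" using R by (simp add: algebra_simps)
  have "dist (fst i) ?y = norm (?y - fst i)" by (simp add: dist_norm norm_minus_commute)
  also have "\<dots> = R * norm (f - (1 / R) *\<^sub>R fst i)" unfolding eq using R by simp
  finally have iy: "dist (fst i) ?y \<le> R" using f R by (metis mult_left_le less_imp_le)
  have ny: "norm ?y \<le> 145 * R"
    using norm_triangle_ineq2[of ?y "fst i"] iy ib by (simp add: dist_norm norm_minus_commute)
  \<comment> \<open>net points have norm at most 145 R, so the balls near \<open>?y\<close> have radius well below R / 2\<close>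
  have inside: "norm (fst k) \<le> 147 * R \<and> snd k \<le> 147 / 1000 * R" if "k \<in> S" "dist (fst k) ?y < 2 * R" for k
    using norm_triangle_ineq2[of "fst k" ?y] that ny S[OF that(1)] by (simp add: dist_norm)
  have "crossing S ?y R"
  proof (rule crossing_of_chain)
    have "cball (fst k) (snd k - 1) \<subseteq> ball (fst k) (snd k)" for k :: "'a \<times> real" by auto
    then have "C \<subseteq> (\<Union>k\<in>S. ball (fst k) (snd k))" using C(2) by blast
    then show "(i, j) \<in> (links S)\<^sup>*"
      using chain_of_connected[OF C(1) _ C(3,4) i(1) _ j(1)] i j by simp
    show "i \<in> S" "0 < R" "dist (fst i) ?y \<le> R" by fact+
    \<comment> \<open>otherwise \<open>p\<close> and \<open>q\<close> would both be close to \<open>?y\<close>, but their distance is at least 4 R\<close>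
    show "2 * R \<le> dist (fst j) ?y"
    proof (rule ccontr)
      assume "\<not> ?thesis"
      then have "snd j \<le> 147 / 1000 * R" "dist (fst j) ?y < 2 * R" using inside[OF j(1)] by auto
      moreover have "dist p q \<le> dist (fst i) p + dist (fst i) ?y + dist (fst j) ?y + dist (fst j) q"
        by (smt (verit) dist_commute dist_triangle)
      ultimately show False using i j iy pq R Si ib by simp
    qed
    show "snd k \<le> R / 2" if "k \<in> S" "dist (fst k) ?y < 2 * R" for k
      using inside[OF that] R by simp
    show "snd l \<le> R / 2" if "(k, l) \<in> links S" "dist (fst k) ?y < 2 * R" for k l
    proof -
      have kl: "k \<in> S" "l \<in> S" "dist (fst k) (fst l) \<le> snd k + snd l" using that by (auto simp: links_def)
      have "norm (fst l) \<le> norm (fst k) + snd k + snd l"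
        using norm_triangle_ineq2[of "fst l" "fst k"] kl by (simp add: dist_norm norm_minus_commute)
      then show ?thesis using inside[OF kl(1) that(2)] S[OF kl(2)] R by simp
    qed
  qed
  then show ?thesis using f by (auto simp: R_def)
qed

section \<open>Unbounded components of open sets\<close>

lemma countable_ball_basis:
  obtains Q :: "('a::euclidean_space \<times> real) set" where "countable Q" "\<And>i. i \<in> Q \<Longrightarrow> 0 < snd i"
    "\<And>V x. open V \<Longrightarrow> x \<in> V \<Longrightarrow> \<exists>i\<in>Q. x \<in> ball (fst i) (snd i) \<and> cball (fst i) (snd i) \<subseteq> V"
proof -
  obtain E :: "'a set" where E: "countable E" "\<And>X. open X \<Longrightarrow> X \<noteq> {} \<Longrightarrow> \<exists>d\<in>E. d \<in> X"
    by (rule countable_dense_setE) blast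
  let ?Q = "E \<times> range (\<lambda>n. 1 / real (Suc n))"
  have "\<exists>i\<in>?Q. x \<in> ball (fst i) (snd i) \<and> cball (fst i) (snd i) \<subseteq> V" if V: "open V" "x \<in> V" for V x
  proof -
    obtain e where e: "0 < e" "cball x e \<subseteq> V" using V open_contains_cball by blast
    obtain n where n: "1 / real (Suc n) < e / 2" using e nat_approx_posE[of "e / 2"] by auto
    obtain d where d: "d \<in> E" "d \<in> ball x (1 / real (Suc n))"
      using E(2)[of "ball x (1 / real (Suc n))"] by auto
    have "cball d (1 / real (Suc n)) \<subseteq> cball x e"
    proof
      fix y assume "y \<in> cball d (1 / real (Suc n))"
      then show "y \<in> cball x e" using dist_triangle[of x y d] d n by auto
    qed
    then show ?thesis using d e by (intro bexI[of _ "(d, 1 / real (Suc n))"]) (auto simp: dist_commute)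
  qed
  then show thesis using E by (intro that[of ?Q]) auto
qed

text \<open>
  An open set contains the compact image of a path from \<open>0\<close> to a distant point, and this image can be
  thickened to a finite union of closed balls taken from a countable supply. This expresses
  unboundedness of the component through countably many conditions of the form \<open>K \<subseteq> V\<close>.
\<close>
lemma unbounded_component_iff:
  fixes V :: "'a::euclidean_space set"
  assumes Q: "\<And>x. x \<in> V \<Longrightarrow> \<exists>i\<in>Q. x \<in> ball (fst i) (snd i) \<and> cball (fst i) (snd i) \<subseteq> V" and V: "open V"
  shows "\<not> bounded (connected_component_set V 0) \<longleftrightarrow>
    (\<forall>n::nat. \<exists>T. finite T \<and> T \<subseteq> Q \<and> connected (\<Union>i\<in>T. cball (fst i) (snd i)) \<and>
       0 \<in> (\<Union>i\<in>T. cball (fst i) (snd i)) \<and> (\<exists>y\<in>(\<Union>i\<in>T. cball (fst i) (snd i)). real n \<le> norm y) \<and>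
       (\<Union>i\<in>T. cball (fst i) (snd i)) \<subseteq> V)" (is "?L \<longleftrightarrow> (\<forall>n. ?R n)")
proof (intro iffI allI)
  let ?U = "connected_component_set V 0"
  fix n :: nat assume ?L
  then obtain y where y: "y \<in> ?U" "real n \<le> norm y" by (auto simp: bounded_iff not_le) (meson less_imp_le)
  then have "0 \<in> ?U" by (simp add: connected_component_in connected_component_refl_eq)
  have "path_connected ?U" by (intro connected_open_path_connected open_connected_component V) simp
  then obtain g where g: "path g" "path_image g \<subseteq> ?U" "pathstart g = 0" "pathfinish g = y"
    using y \<open>0 \<in> ?U\<close> unfolding path_connected_def by blast
  let ?P = "path_image g"
  have P: "compact ?P" "connected ?P" "0 \<in> ?P" "y \<in> ?P"
    using g pathstart_in_path_image[of g] pathfinish_in_path_image[of g]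
    by (auto simp: compact_path_image connected_path_image)
  have PV: "?P \<subseteq> V" using g connected_component_subset by blast
  let ?C = "{i \<in> Q. ball (fst i) (snd i) \<inter> ?P \<noteq> {} \<and> cball (fst i) (snd i) \<subseteq> V}"
  have "?P \<subseteq> (\<Union>i\<in>?C. ball (fst i) (snd i))"
  proof
    fix p assume p: "p \<in> ?P"
    then obtain i where i: "i \<in> Q" "p \<in> ball (fst i) (snd i)" "cball (fst i) (snd i) \<subseteq> V" using Q PV by blast
    then have "ball (fst i) (snd i) \<inter> ?P \<noteq> {}" using p by blast
    with i have "i \<in> ?C" by simp
    then show "p \<in> (\<Union>i\<in>?C. ball (fst i) (snd i))" using i(2) by (rule UN_I)
  qed
  then obtain T where T: "T \<subseteq> ?C" "finite T" "?P \<subseteq> (\<Union>i\<in>T. ball (fst i) (snd i))"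
    by (rule compactE_image[OF P(1), of ?C "\<lambda>i. ball (fst i) (snd i)", rotated]) (assumption | rule open_ball)+
  let ?K = "\<Union>i\<in>T. cball (fst i) (snd i)"
  have PK: "?P \<subseteq> ?K" by (rule subset_trans[OF T(3)]) (intro UN_mono subset_refl ball_subset_cball)
  have "T \<noteq> {}" using T P by auto
  then have "?K = \<Union>((\<lambda>i. ?P \<union> cball (fst i) (snd i)) ` T)" using PK by blast
  also have "connected \<dots>"
  proof (rule connected_Union)
    fix s assume "s \<in> (\<lambda>i. ?P \<union> cball (fst i) (snd i)) ` T"
    then obtain i where i: "i \<in> T" "s = ?P \<union> cball (fst i) (snd i)" by blast
    have "ball (fst i) (snd i) \<inter> ?P \<noteq> {}" using T(1) i by blast
    then have "?P \<inter> cball (fst i) (snd i) \<noteq> {}" using ball_subset_cball by blast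
    then show "connected s" unfolding i(2)
      by (intro connected_Un P(2) convex_connected convex_cball)
  next
    show "\<Inter>((\<lambda>i. ?P \<union> cball (fst i) (snd i)) ` T) \<noteq> {}" using P(3) by blast
  qed
  finally have "connected ?K" .
  moreover have "T \<subseteq> Q" "?K \<subseteq> V" using T(1) by auto
  moreover have "0 \<in> ?K" "y \<in> ?K" using P(3,4) by (blast intro: subsetD[OF PK])+
  ultimately show "?R n" using T(2) y(2) by (intro exI[of _ T] conjI bexI[of _ y])
next
  assume R: "\<forall>n. ?R n"
  show ?L
  proof
    assume "bounded (connected_component_set V 0)"
    then obtain B where B: "\<And>x. x \<in> connected_component_set V 0 \<Longrightarrow> norm x \<le> B" by (auto simp: bounded_iff)
    obtain n :: nat where n: "B < real n" using reals_Archimedean2 by blast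
    from spec[OF R, of n] obtain T y where T: "connected (\<Union>i\<in>T. cball (fst i) (snd i))"
        "0 \<in> (\<Union>i\<in>T. cball (fst i) (snd i))" "(\<Union>i\<in>T. cball (fst i) (snd i)) \<subseteq> V"
      and y: "y \<in> (\<Union>i\<in>T. cball (fst i) (snd i))" "real n \<le> norm y"
      by (elim exE conjE bexE)
    from T y(1) have "y \<in> connected_component_set V 0"
      unfolding connected_component_def mem_Collect_eq by (intro exI conjI)
    then show False using B[of y] n y(2) by simp
  qed
qed

lemma cball_Int_cball_nonempty:
  fixes x y :: "'a::euclidean_space"
  assumes "0 \<le> r" "0 \<le> s" "dist x y \<le> r + s"
  shows "cball x r \<inter> cball y s \<noteq> {}"
proof (cases "r + s = 0")
  case False
  define t where "t = r / (r + s)"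
  have t: "0 \<le> t" "t \<le> 1" using assms False by (auto simp: t_def divide_le_eq)
  define p where "p = x + t *\<^sub>R (y - x)"
  have "dist x p = t * dist x y" using t by (simp add: p_def dist_norm norm_minus_commute)
  also have "\<dots> \<le> t * (r + s)" using t assms by (intro mult_left_mono)
  finally have 1: "dist x p \<le> r" using False by (simp add: t_def)
  have "y - p = (1 - t) *\<^sub>R (y - x)" by (simp add: p_def algebra_simps)
  then have "dist y p = (1 - t) * dist x y" using t by (simp add: dist_norm norm_minus_commute)
  also have "\<dots> \<le> (1 - t) * (r + s)" using t assms by (intro mult_left_mono) auto
  also have "\<dots> = s" using False by (simp add: t_def field_simps)
  finally show ?thesis using 1 by auto
next
  case True
  then have "r = 0" "s = 0" "x = y" using assms by auto
  then show ?thesis by auto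
qed

section \<open>Crossing probabilities across scales\<close>

text \<open>
  Properties of the sets of active indices in two disjoint finite index sets are independent, whatever
  the properties are: on finite products of \<open>bool\<close> every set is measurable.
\<close>
lemma (in prob_space) prob_finite_pattern_indep:
  fixes X :: "'i \<Rightarrow> 'a \<Rightarrow> bool"
  assumes ind: "indep_vars (\<lambda>_. count_space UNIV) X I"
    and J: "finite J" "J \<subseteq> I" and K: "finite K" "K \<subseteq> I" and JK: "J \<inter> K = {}"
  shows "prob {w \<in> space M. P {i \<in> J. X i w} \<and> Q {i \<in> K. X i w}} =
     prob {w \<in> space M. P {i \<in> J. X i w}} * prob {w \<in> space M. Q {i \<in> K. X i w}}"
proof -
  let ?N = "\<lambda>J. PiM J (\<lambda>_. count_space (UNIV :: bool set))"
  have "indep_vars (\<lambda>j. PiM (case_bool J K j) (\<lambda>_. count_space UNIV))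
      (\<lambda>j w. restrict (\<lambda>i. X i w) (case_bool J K j)) UNIV"
    using J K JK by (intro indep_vars_restrict[OF ind]) (auto simp: disjoint_family_on_def split: bool.splits)
  then have "indep_vars (case_bool (?N J) (?N K))
      (case_bool (\<lambda>w. restrict (\<lambda>i. X i w) J) (\<lambda>w. restrict (\<lambda>i. X i w) K)) UNIV"
    by (rule indep_vars_cong[THEN iffD1, rotated -1]) (auto split: bool.splits)
  then have iv: "indep_var (?N J) (\<lambda>w. restrict (\<lambda>i. X i w) J) (?N K) (\<lambda>w. restrict (\<lambda>i. X i w) K)"
    by (simp add: indep_var_def)
  have sets: "{f \<in> space (?N L). A {i \<in> L. f i}} \<in> sets (?N L)" if "finite L" for L A
    using that by (subst (1 2) count_space_PiM_finite) auto
  have vim: "(\<lambda>w. restrict (\<lambda>i. X i w) L) -` {f \<in> space (?N L). A {i \<in> L. f i}} \<inter> space M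
      = {w \<in> space M. A {i \<in> L. X i w}}" for L A
  proof -
    have "{i \<in> L. restrict (\<lambda>i. X i w) L i} = {i \<in> L. X i w}" for w by auto
    then show ?thesis unfolding vimage_def mem_Collect_eq by (auto simp only: space_PiM) auto
  qed
  let ?P = "{f \<in> space (?N J). P {i \<in> J. f i}}" and ?Q = "{f \<in> space (?N K). Q {i \<in> K. f i}}"
  have "(\<lambda>w. (restrict (\<lambda>i. X i w) J, restrict (\<lambda>i. X i w) K)) -` (?P \<times> ?Q) \<inter> space M
      = ((\<lambda>w. restrict (\<lambda>i. X i w) J) -` ?P \<inter> space M) \<inter> ((\<lambda>w. restrict (\<lambda>i. X i w) K) -` ?Q \<inter> space M)"
    by blast
  also have "\<dots> = {w \<in> space M. P {i \<in> J. X i w} \<and> Q {i \<in> K. X i w}}"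
    using vim[of J P] vim[of K Q] by blast
  finally show ?thesis
    using indep_varD[OF iv sets[OF J(1), of P] sets[OF K(1), of Q]] by (simp only: vim[of J P] vim[of K Q])
qed

lemma (in prob_space) finite_pattern_event:
  fixes X :: "'i \<Rightarrow> 'a \<Rightarrow> bool"
  assumes X: "\<And>i. i \<in> J \<Longrightarrow> {w \<in> space M. X i w} \<in> events" and J: "finite J"
  shows "{w \<in> space M. P {i \<in> J. X i w}} \<in> events"
proof -
  have "{w \<in> space M. P {i \<in> J. X i w}} =
      (\<Union>T\<in>{T. T \<subseteq> J \<and> P T}. {w \<in> space M. \<forall>i\<in>J. X i w = (i \<in> T)})"
  proof -
    have "w \<in> (\<Union>T\<in>{T. T \<subseteq> J \<and> P T}. {w \<in> space M. \<forall>i\<in>J. X i w = (i \<in> T)})"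
      if "w \<in> space M" "P {i \<in> J. X i w}" for w
      using that by (intro UN_I[of "{i \<in> J. X i w}"]) auto
    moreover have "{i \<in> J. X i w} = T" if "T \<subseteq> J" "\<forall>i\<in>J. X i w = (i \<in> T)" for w T
      using that by auto
    ultimately show ?thesis by force
  qed
  moreover have "{w \<in> space M. \<forall>i\<in>J. X i w = (i \<in> T)} \<in> events" for T
  proof (intro sets.sets_Collect_finite_All J)
    fix i assume "i \<in> J"
    then show "{w \<in> space M. X i w = (i \<in> T)} \<in> events"
      using X[of i] sets.sets_Collect_neg[of M "X i"] by (cases "i \<in> T") auto
  qed
  ultimately show ?thesis using J by (auto intro!: sets.finite_UN)
qed

text \<open>
  The majorant of the crossing probabilities. Once \<open>a k \<le> 1 / (2 * n)\<close>, the recursion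
  \<open>a (Suc k) = n * a k ^ 2 + s (Suc k)\<close> is dominated by this linear one; here \<open>n\<close> stands for
  the number of pairs of net points.
\<close>
fun scale_bound :: "(nat \<Rightarrow> real) \<Rightarrow> nat \<Rightarrow> real" where
  "scale_bound s 0 = s 0"
| "scale_bound s (Suc k) = scale_bound s k / 2 + s (Suc k)"

lemma scale_bound_nonneg: "(\<And>k. 0 \<le> s k) \<Longrightarrow> 0 \<le> scale_bound s k"
  by (induction k) auto

lemma scale_bound_summable:
  assumes s: "\<And>k. 0 \<le> s k" "summable s"
  shows "summable (scale_bound s)" "suminf (scale_bound s) \<le> 2 * suminf s" "scale_bound s k \<le> suminf s"
proof -
  \<comment> \<open>telescoping the recursion\<close>
  have eq: "sum (scale_bound s) {..n} + scale_bound s n = 2 * sum s {..n}" for n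
    by (induction n) auto
  have le: "sum s {..n} \<le> suminf s" for n using s by (intro sum_le_suminf) auto
  have b: "sum (scale_bound s) {..n} \<le> 2 * suminf s" for n
    using eq[of n] le[of n] scale_bound_nonneg[of s n, OF s(1)] by linarith
  show sm: "summable (scale_bound s)"
    by (rule bounded_imp_summable[where B = "2 * suminf s"]) (use scale_bound_nonneg s b in auto)
  show "suminf (scale_bound s) \<le> 2 * suminf s"
  proof (rule suminf_le_const[OF sm])
    fix n
    have "sum (scale_bound s) {..<n} \<le> sum (scale_bound s) {..n}"
      using scale_bound_nonneg[of s] s by (intro sum_mono2) auto
    then show "sum (scale_bound s) {..<n} \<le> 2 * suminf s" using b[of n] by simp
  qed
  have "scale_bound s k \<le> sum s {..k}"
  proof (induction k)
    case (Suc k)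
    then show ?case using scale_bound_nonneg[of s k] s(1) by simp
  qed simp
  then show "scale_bound s k \<le> suminf s" using le[of k] by simp
qed

lemma (in prob_space)
  fixes X :: "('b::real_normed_vector \<times> real) \<Rightarrow> 'a \<Rightarrow> bool"
  assumes ind: "indep_vars (\<lambda>_. count_space UNIV) X I"
    and fin: "\<And>y R. finite (near I y R)"
  shows crossing_event: "{w \<in> space M. crossing {i \<in> I. X i w} y R} \<in> events"
    and crossings_indep: "6 * R < dist y z \<Longrightarrow>
      \<P>(w in M. crossing {i \<in> I. X i w} y R \<and> crossing {i \<in> I. X i w} z R) =
      \<P>(w in M. crossing {i \<in> I. X i w} y R) * \<P>(w in M. crossing {i \<in> I. X i w} z R)"
proof -
  have Xev: "{w \<in> space M. X i w} \<in> events" if "i \<in> I" for i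
    using ind that unfolding indep_vars_def2 pred_def[symmetric] by simp
  define pat where "pat y R S \<longleftrightarrow> (\<exists>i j. i \<in> S \<and> (i, j) \<in> (links S)\<^sup>* \<and>
     dist (fst i) y \<le> R \<and> 2 * R \<le> dist (fst j) y)" for y :: 'b and R S
  have "near {i \<in> I. X i w} y R = {i \<in> near I y R. X i w}" for w y R by (auto simp: near_def)
  then have cr: "crossing {i \<in> I. X i w} y R \<longleftrightarrow> pat y R {i \<in> near I y R. X i w}" for w y R
    by (simp add: crossing_def pat_def)
  have nI: "near I y R \<subseteq> I" for y R by (auto simp: near_def)
  show "{w \<in> space M. crossing {i \<in> I. X i w} y R} \<in> events"
    unfolding cr using nI by (intro finite_pattern_event[OF Xev fin]) auto
  assume far: "6 * R < dist y z"
  have "near I y R \<inter> near I z R = {}"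
  proof (rule ccontr)
    assume "near I y R \<inter> near I z R \<noteq> {}"
    then obtain i where "dist (fst i) y \<le> 3 * R" "dist (fst i) z \<le> 3 * R" by (auto simp: near_def)
    then show False using dist_triangle3[of y z "fst i"] far by simp
  qed
  from prob_finite_pattern_indep[OF ind fin nI fin nI this, of "pat y R" "pat z R"]
  show "\<P>(w in M. crossing {i \<in> I. X i w} y R \<and> crossing {i \<in> I. X i w} z R) =
      \<P>(w in M. crossing {i \<in> I. X i w} y R) * \<P>(w in M. crossing {i \<in> I. X i w} z R)"
    unfolding cr .
qed

text \<open>
  Induction on the scale. At scale \<open>R0 * 9 ^ Suc k\<close> either one of the balls with radius above
  \<open>R0 * 9 ^ k / 2\<close> is present, which the union bound controls by \<open>s (Suc k)\<close>, or \<open>crossing_split\<close> gives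
  two independent crossings at scale \<open>R0 * 9 ^ k\<close>. There are at most \<open>card F ^ 2\<close> pairs of net points, and
  the smallness of \<open>suminf s\<close> turns the square of the previous bound into half of it.
\<close>
lemma (in prob_space) prob_crossing_le:
  fixes X :: "('b::euclidean_space \<times> real) \<Rightarrow> 'a \<Rightarrow> bool" and s :: "nat \<Rightarrow> real" and F :: "'b set"
  assumes ind: "indep_vars (\<lambda>_. count_space UNIV) X I"
    and fin: "\<And>y R. finite (near I y R)"
    and F: "finite F" "cball 0 27 \<subseteq> (\<Union>f\<in>F. cball f 1)" and R0: "0 < R0"
    and s: "\<And>k. 0 \<le> s k" "summable s" "2 * (card F)\<^sup>2 * suminf s \<le> 1"
    and s0: "\<And>y. (\<Sum>i\<in>near I y R0. prob {w \<in> space M. X i w}) \<le> s 0"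
    and s_Suc: "\<And>y k. (\<Sum>i\<in>{i\<in>near I y (R0 * 9 ^ Suc k). R0 * 9 ^ k / 2 < snd i}. prob {w \<in> space M. X i w}) \<le> s (Suc k)"
  shows "prob {w \<in> space M. crossing {i \<in> I. X i w} y (R0 * 9 ^ k)} \<le> scale_bound s k"
proof -
  have Xev: "{w \<in> space M. X i w} \<in> events" if "i \<in> I" for i
    using ind that unfolding indep_vars_def2 pred_def[symmetric] by simp
  have Xev': "{w \<in> space M. X i w} \<in> events" if "i \<in> near I y R" for i y R
    using Xev that by (auto simp: near_def)
  have near_I: "near {i \<in> I. X i w} y R = {i \<in> near I y R. X i w}" for w y R by (auto simp: near_def)
  define G where "G y R = {w \<in> space M. crossing {i \<in> I. X i w} y R}" for y R
  have Gev: "G y R \<in> events" for y R unfolding G_def by (rule crossing_event[OF ind fin])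
  have indG: "prob (G y R \<inter> G z R) = prob (G y R) * prob (G z R)" if "6 * R < dist y z" for y z R
  proof -
    have "G y R \<inter> G z R = {w \<in> space M. crossing {i \<in> I. X i w} y R \<and> crossing {i \<in> I. X i w} z R}"
      by (auto simp: G_def)
    then show ?thesis using crossings_indep[OF ind fin that] by (simp add: G_def)
  qed
  let ?a = "scale_bound s"
  show ?thesis
  proof (induction k arbitrary: y)
    case 0
    have "G y R0 \<subseteq> (\<Union>i\<in>near I y R0. {w \<in> space M. X i w})"
      by (auto simp: G_def crossing_def near_I)
    then have "prob (G y R0) \<le> prob (\<Union>i\<in>near I y R0. {w \<in> space M. X i w})"
      using fin Xev' by (intro finite_measure_mono sets.finite_UN) auto
    also have "\<dots> \<le> (\<Sum>i\<in>near I y R0. prob {w \<in> space M. X i w})"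
      using fin Xev' by (intro finite_measure_subadditive_finite) auto
    also have "\<dots> \<le> s 0" by (rule s0)
    finally show ?case by (simp add: G_def)
  next
    case (Suc k)
    define R where "R = R0 * 9 ^ k"
    have R: "0 < R" using R0 by (simp add: R_def)
    have IH: "prob (G y R) \<le> ?a k" for y using Suc by (simp add: G_def R_def)
    let ?W = "{i\<in>near I y (9 * R). R / 2 < snd i}"
    let ?FF = "{(f, g). f \<in> F \<and> g \<in> F \<and> 6 < dist f g}"
    let ?A = "\<Union>i\<in>?W. {w \<in> space M. X i w}"
    let ?B = "\<Union>(f, g)\<in>?FF. G (y + R *\<^sub>R f) R \<inter> G (y + R *\<^sub>R g) R"
    have finW: "finite ?W" using fin by auto
    have FF: "?FF \<subseteq> F \<times> F" by auto
    have finFF: "finite ?FF" using finite_subset[OF FF] F by auto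
    have Wev: "?A \<in> events" using finW Xev' by (intro sets.finite_UN) auto
    have Bev: "?B \<in> events" using finFF Gev by (intro sets.finite_UN) auto
    have "G y (9 * R) \<subseteq> ?A \<union> ?B"
    proof
      fix w assume w: "w \<in> G y (9 * R)"
      show "w \<in> ?A \<union> ?B"
      proof (cases "w \<in> ?A")
        case False
        have "snd i \<le> R / 2" if "i \<in> near {i \<in> I. X i w} y (9 * R)" for i
          
        proof (rule ccontr)
          assume "\<not> snd i \<le> R / 2"
          then have "i \<in> ?W" "X i w" using that by (auto simp: near_I)
          moreover have "w \<in> space M" using w by (simp add: G_def)
          ultimately show False using False by blast
        qed
        then show ?thesis
          using crossing_split[OF F(2) R, of "{i \<in> I. X i w}" y] w by (auto simp: G_def)
      qed auto
    qed
    then have "prob (G y (9 * R)) \<le> prob (?A \<union> ?B)" using Wev Bev by (intro finite_measure_mono) auto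
    also have "\<dots> \<le> prob ?A + prob ?B" using Wev Bev by (rule measure_Un_le)
    also have "prob ?A \<le> s (Suc k)"
    proof -
      have "prob ?A \<le> (\<Sum>i\<in>?W. prob {w \<in> space M. X i w})"
        using finW Xev' by (intro finite_measure_subadditive_finite) auto
      also have "\<dots> \<le> s (Suc k)" using s_Suc[of y k] by (simp add: R_def mult_ac)
      finally show ?thesis .
    qed
    also have "prob ?B \<le> ?a k / 2"
    proof -
      have a: "0 \<le> ?a k" "?a k \<le> suminf s" using scale_bound_nonneg scale_bound_summable s by auto
      have "prob ?B \<le> (\<Sum>(f, g)\<in>?FF. prob (G (y + R *\<^sub>R f) R \<inter> G (y + R *\<^sub>R g) R))"
        using finite_measure_subadditive_finite[OF finFF, of "\<lambda>(f, g). G (y + R *\<^sub>R f) R \<inter> G (y + R *\<^sub>R g) R"] Gev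
        by (auto simp: case_prod_unfold)
      also have "\<dots> \<le> (\<Sum>_\<in>?FF. (?a k)\<^sup>2)"
      proof (intro sum_mono)
        fix h assume h: "h \<in> ?FF"
        obtain f g where fg: "h = (f, g)" by force
        have "dist (y + R *\<^sub>R f) (y + R *\<^sub>R g) = R * dist f g"
          using R by (simp add: dist_norm flip: scaleR_diff_right)
        then have "6 * R < dist (y + R *\<^sub>R f) (y + R *\<^sub>R g)" using h R fg by simp
        then show "(case h of (f, g) \<Rightarrow> prob (G (y + R *\<^sub>R f) R \<inter> G (y + R *\<^sub>R g) R)) \<le> (?a k)\<^sup>2"
          using IH a by (simp add: fg indG power2_eq_square mult_mono)
      qed
      also have "\<dots> = real (card ?FF) * (?a k)\<^sup>2" by simp
      also have "\<dots> \<le> real ((card F)\<^sup>2) * (?a k)\<^sup>2"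
      proof (intro mult_right_mono of_nat_mono)
        show "card ?FF \<le> (card F)\<^sup>2"
          using card_mono[OF _ FF] F by (simp add: card_cartesian_product power2_eq_square)
      qed simp
      also have "\<dots> = ((card F)\<^sup>2 * ?a k) * ?a k" by (simp add: power2_eq_square)
      also have "\<dots> \<le> (1 / 2) * ?a k"
      proof (intro mult_right_mono)
        have "(card F)\<^sup>2 * ?a k \<le> (card F)\<^sup>2 * suminf s" using a by (intro mult_left_mono) auto
        then show "(card F)\<^sup>2 * ?a k \<le> 1 / 2" using s(3) by simp
      qed (use a in auto)
      finally show ?thesis by simp
    qed
    finally show ?case by (simp add: G_def R_def mult_ac)
  qed
qed

section \<open>Lattice cells\<close>

text \<open>
  Rounding down every coordinate to a multiple of \<open>\<delta>\<close>. The lattice points are represented as vectors,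
  so that a cell of rounded balls is indexed by a ball.
\<close>
definition lattice_point :: "real \<Rightarrow> 'a::euclidean_space \<Rightarrow> 'a" where
  "lattice_point \<delta> x = (\<Sum>b\<in>Basis. (\<delta> * of_int \<lfloor>(x \<bullet> b) / \<delta>\<rfloor>) *\<^sub>R b)"

lemma lattice_point_inner: "b \<in> Basis \<Longrightarrow> lattice_point \<delta> x \<bullet> b = \<delta> * of_int \<lfloor>(x \<bullet> b) / \<delta>\<rfloor>"
  by (simp add: lattice_point_def)

lemma lattice_point_0 [simp]: "lattice_point \<delta> 0 = 0"
  by (simp add: lattice_point_def)

lemma lattice_point_coord:
  fixes \<delta> :: real
  assumes "0 < \<delta>" "b \<in> Basis"
  shows "lattice_point \<delta> x \<bullet> b \<le> x \<bullet> b" "x \<bullet> b < lattice_point \<delta> x \<bullet> b + \<delta>"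
proof -
  have "of_int \<lfloor>(x \<bullet> b) / \<delta>\<rfloor> * \<delta> \<le> (x \<bullet> b) / \<delta> * \<delta>" "(x \<bullet> b) / \<delta> * \<delta> < (of_int \<lfloor>(x \<bullet> b) / \<delta>\<rfloor> + 1) * \<delta>"
    using assms by (intro mult_right_mono mult_strict_right_mono; linarith)+
  then show "lattice_point \<delta> x \<bullet> b \<le> x \<bullet> b" "x \<bullet> b < lattice_point \<delta> x \<bullet> b + \<delta>"
    using assms by (simp_all add: lattice_point_inner algebra_simps)
qed

lemma dist_same_lattice_point:
  fixes x y :: "'a::euclidean_space" and \<delta> :: real
  assumes "0 < \<delta>" "lattice_point \<delta> x = lattice_point \<delta> y"
  shows "dist x y \<le> DIM('a) * \<delta>"
proof -
  have "\<bar>(x - y) \<bullet> b\<bar> \<le> \<delta>" if "b \<in> Basis" for b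
    using lattice_point_coord[of \<delta> b x] lattice_point_coord[of \<delta> b y] assms that
    by (simp add: inner_diff_left abs_le_iff)
  then have "(\<Sum>b\<in>Basis. \<bar>(x - y) \<bullet> b\<bar>) \<le> (\<Sum>b\<in>(Basis::'a set). \<delta>)" by (intro sum_mono) auto
  then show ?thesis using norm_le_l1[of "x - y"] by (simp add: dist_norm)
qed

lemma lattice_point_idem [simp]: "lattice_point \<delta> (lattice_point \<delta> x) = lattice_point \<delta> x"
proof (cases "\<delta> = 0")
  case False
  then show ?thesis unfolding lattice_point_def[of \<delta> "lattice_point \<delta> x"] 
    by (simp add: lattice_point_inner cong: sum.cong) (simp add: lattice_point_def)
qed (simp add: lattice_point_def)

lemma dist_lattice_point:
  fixes x :: "'a::euclidean_space" and \<delta> :: real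
  shows "0 < \<delta> \<Longrightarrow> dist x (lattice_point \<delta> x) \<le> DIM('a) * \<delta>"
  by (intro dist_same_lattice_point) auto

lemma lattice_point_borel [measurable]: "lattice_point \<delta> \<in> borel_measurable borel"
  unfolding lattice_point_def[abs_def] by measurable

lemma finite_lattice_points:
  fixes \<delta> :: real
  assumes \<delta>: "0 < \<delta>"
  shows "finite {c \<in> range (lattice_point \<delta>). dist c (y :: 'a::euclidean_space) \<le> r}"
proof -
  define N where "N = \<lceil>(norm y + r) / \<delta>\<rceil>"
  have "{c \<in> range (lattice_point \<delta>). dist c y \<le> r} \<subseteq>
      (\<lambda>f. \<Sum>b\<in>Basis. (\<delta> * of_int (f b)) *\<^sub>R b) ` (Basis \<rightarrow>\<^sub>E {- N..N})"
  proof
    fix c assume "c \<in> {c \<in> range (lattice_point \<delta>). dist c y \<le> r}"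
    then obtain x where c: "c = lattice_point \<delta> x" "dist c y \<le> r" by auto
    define f where "f = restrict (\<lambda>b. \<lfloor>(x \<bullet> b) / \<delta>\<rfloor>) Basis"
    have "f b \<in> {- N..N}" if b: "b \<in> Basis" for b
    proof -
      have "norm c \<le> norm y + r" using c norm_triangle_ineq2[of c y] by (simp add: dist_norm)
      then have "\<bar>c \<bullet> b\<bar> \<le> norm y + r" using Basis_le_norm[OF b, of c] by simp
      moreover have "\<bar>c \<bullet> b\<bar> = \<delta> * \<bar>of_int (f b)\<bar>"
        using \<delta> b c by (simp add: f_def lattice_point_inner abs_mult)
      ultimately have "\<bar>real_of_int (f b)\<bar> \<le> (norm y + r) / \<delta>" using \<delta> by (simp add: field_simps)
      then have "\<bar>f b\<bar> \<le> N" unfolding N_def by linarith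
      then show ?thesis by auto
    qed
    moreover have "c = (\<Sum>b\<in>Basis. (\<delta> * of_int (f b)) *\<^sub>R b)"
      by (simp add: c lattice_point_def f_def)
    ultimately show "c \<in> (\<lambda>f. \<Sum>b\<in>Basis. (\<delta> * of_int (f b)) *\<^sub>R b) ` (Basis \<rightarrow>\<^sub>E {- N..N})"
      by (intro image_eqI[of _ _ f]) (auto simp: f_def)
  qed
  then show ?thesis by (rule finite_subset) (intro finite_imageI finite_PiE, auto)
qed

lemma countable_lattice:
  fixes \<delta> :: real 
  assumes "0 < \<delta>" shows "countable (range (lattice_point \<delta> :: 'a::euclidean_space \<Rightarrow> 'a))"
proof -
  have "range (lattice_point \<delta> :: 'a \<Rightarrow> 'a) = (\<Union>n::nat. {c \<in> range (lattice_point \<delta>). dist c 0 \<le> n})"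
    by (auto simp: real_arch_simple)
  also have "countable \<dots>"
    using finite_lattice_points[OF assms] by (intro countable_UN[OF countableI_type] countable_finite)
  finally show ?thesis .
qed

text \<open>
  The cell contains the open cube of side \<open>\<delta>\<close> with lowest corner \<open>c\<close>.
\<close>
lemma emeasure_lattice_cell_ge:
  fixes \<delta> :: real
  assumes \<delta>: "0 < \<delta>" and c: "c \<in> range (lattice_point \<delta>)"
  shows "ennreal (\<delta> ^ DIM('a)) \<le> emeasure lborel {x :: 'a::euclidean_space. lattice_point \<delta> x = c}"
proof -
  have "box c (c + \<delta> *\<^sub>R One) \<subseteq> {x. lattice_point \<delta> x = c}"
  proof
    fix x assume x: "x \<in> box c (c + \<delta> *\<^sub>R One)"
    obtain y where y: "c = lattice_point \<delta> y" using c by auto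
    have "\<lfloor>(x \<bullet> b) / \<delta>\<rfloor> = \<lfloor>(y \<bullet> b) / \<delta>\<rfloor>" if b: "b \<in> Basis" for b
    proof -
      have "c \<bullet> b < x \<bullet> b" "x \<bullet> b < c \<bullet> b + \<delta>"
        using x b by (auto simp: mem_box inner_add_left)
      then have "of_int \<lfloor>(y \<bullet> b) / \<delta>\<rfloor> * \<delta> < x \<bullet> b" "x \<bullet> b < (of_int \<lfloor>(y \<bullet> b) / \<delta>\<rfloor> + 1) * \<delta>"
        using b by (simp_all add: y lattice_point_inner algebra_simps)
      then show ?thesis using \<delta> by (intro floor_unique) (simp_all add: field_simps)
    qed
    then show "x \<in> {x. lattice_point \<delta> x = c}" by (simp add: y lattice_point_def cong: sum.cong)
  qed
  then have "emeasure lborel (box c (c + \<delta> *\<^sub>R One)) \<le> emeasure lborel {x. lattice_point \<delta> x = c}"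
    by (intro emeasure_mono) auto
  then show ?thesis using \<delta> by (simp add: emeasure_lborel_box_eq inner_add_left)
qed

section \<open>Counts of a Poisson process in disjoint cells\<close>

lemma (in prob_space) indep_vars_reindex:
  assumes inj: "inj_on f I" and ind: "indep_vars M' X (f ` I)"
  shows "indep_vars (\<lambda>i. M' (f i)) (\<lambda>i. X (f i)) I"
  unfolding indep_vars_def2
proof (intro conjI ballI)
  show "random_variable (M' (f i)) (X (f i))" if "i \<in> I" for i
    using ind that by (auto simp: indep_vars_def2)
  define S where "S n = {X n -` A \<inter> space M |A. A \<in> sets (M' n)}" for n
  have S: "indep_sets S (f ` I)" using ind unfolding indep_vars_def2 S_def by auto
  have "indep_sets (\<lambda>i. S (f i)) I"
  proof (rule indep_setsI)
    show "S (f i) \<subseteq> events" if "i \<in> I" for i using S that by (auto simp: indep_sets_def)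
    fix A J assume J: "J \<noteq> {}" "J \<subseteq> I" "finite J" and A: "\<forall>j\<in>J. A j \<in> S (f j)"
    have injJ: "inj_on f J" using inj J inj_on_subset by blast
    define B where "B = A \<circ> the_inv_into J f"
    have B: "B (f j) = A j" if "j \<in> J" for j using that injJ by (simp add: B_def the_inv_into_f_f)
    have "prob (\<Inter>n\<in>f ` J. B n) = (\<Prod>n\<in>f ` J. prob (B n))"
      using J A B by (intro indep_setsD[OF S]) auto
    then show "prob (\<Inter>j\<in>J. A j) = (\<Prod>j\<in>J. prob (A j))"
      using injJ B by (simp add: prod.reindex)
  qed
  then show "indep_sets (\<lambda>i. {X (f i) -` A \<inter> space M |A. A \<in> sets (M' (f i))}) I" by (simp add: S_def)
qed

locale boolean_model = mu: prob_space \<mu> for \<mu> :: "real measure" +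
  fixes M :: "'w measure" and \<omega> :: "'w \<Rightarrow> ('a::euclidean_space \<times> real) set" and l :: real
  assumes sets_mu [measurable_cong]: "sets \<mu> = sets borel"
    and radius_nonneg: "AE r in \<mu>. 0 \<le> r"
    and moment: "(\<integral>\<^sup>+ r. ennreal (r ^ DIM('a)) \<partial>\<mu>) < \<infinity>"
    and l: "0 \<le> l"
    and ppp: "poisson_point_process M \<omega> (boolean_intensity l \<mu>)"
begin

abbreviation N :: "('a \<times> real) measure" where "N \<equiv> boolean_intensity l \<mu>"

sublocale M: prob_space M
  using ppp by (simp add: poisson_point_process_def)

lemma sets_N [measurable_cong]: "sets N = sets borel"
proof -
  have "sets N = sets (lborel \<Otimes>\<^sub>M \<mu> :: ('a \<times> real) measure)" by (simp add: boolean_intensity_def)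
  also have "\<dots> = sets (borel \<Otimes>\<^sub>M borel)" by (rule sets_pair_measure_cong) (auto simp: sets_mu)
  finally show ?thesis by (simp only: borel_prod)
qed

lemma emeasure_N:
  assumes "A \<in> sets borel"
  shows "emeasure N A = ennreal l * (\<integral>\<^sup>+ z. emeasure lborel ((\<lambda>x. (x, z)) -` A) \<partial>\<mu>)"
proof -
  interpret pair_sigma_finite "lborel :: 'a measure" \<mu> ..
  have "A \<in> sets (lborel \<Otimes>\<^sub>M \<mu>)" using assms sets_N by (simp add: boolean_intensity_def)
  then show ?thesis by (simp add: boolean_intensity_def emeasure_pair_measure_alt2)
qed

text \<open>
  The expected number of points \<open>(x, z)\<close> with \<open>x\<close> within a distance \<open>f z\<close> of \<open>y\<close>. Upper bounds for expected
  numbers of balls all take this form, and the power \<open>f z ^ DIM('a)\<close> is where the moment of order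
  \<open>DIM('a)\<close> enters.
\<close>
lemma emeasure_N_balls:
  assumes [measurable]: "f \<in> borel_measurable borel" "B \<in> sets borel" and f: "\<And>z. z \<in> B \<Longrightarrow> 0 \<le> f z"
  shows "{(x, z). dist x y \<le> f z \<and> z \<in> B} \<in> sets borel"
    and "emeasure N {(x, z). dist x y \<le> f z \<and> z \<in> B} =
      ennreal (l * unit_ball_vol DIM('a)) * (\<integral>\<^sup>+ z\<in>B. ennreal (f z ^ DIM('a)) \<partial>\<mu>)"
proof -
  have "{(x, z). dist x y \<le> f z \<and> z \<in> B} \<in> sets (borel \<Otimes>\<^sub>M borel)"
  proof -
    have "{p \<in> space (borel \<Otimes>\<^sub>M borel). dist (fst p) y \<le> f (snd p) \<and> snd p \<in> B} \<in> sets (borel \<Otimes>\<^sub>M borel)"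
      by measurable
    then show ?thesis by (simp add: space_pair_measure case_prod_unfold)
  qed
  then show s: "{(x, z). dist x y \<le> f z \<and> z \<in> B} \<in> sets borel" by (simp only: borel_prod)
  have "emeasure N {(x, z). dist x y \<le> f z \<and> z \<in> B}
      = ennreal l * (\<integral>\<^sup>+ z. ennreal (unit_ball_vol DIM('a)) * (ennreal (f z ^ DIM('a)) * indicator B z) \<partial>\<mu>)"
  proof (subst emeasure_N[OF s], intro arg_cong2[where f = "(*)"] nn_integral_cong refl)
    fix z
    show "emeasure lborel ((\<lambda>x. (x, z)) -` {(x, z). dist x y \<le> f z \<and> z \<in> B}) =
        ennreal (unit_ball_vol DIM('a)) * (ennreal (f z ^ DIM('a)) * indicator B z)"
    proof (cases "z \<in> B")
      case True
      have "(\<lambda>x. (x, z)) -` {(x, z). dist x y \<le> f z \<and> z \<in> B} = cball y (f z)"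
        using True by (auto simp: dist_commute)
      then show ?thesis using True f[OF True] by (simp add: emeasure_cball ennreal_mult)
    qed auto
  qed
  also have "\<dots> = ennreal (l * unit_ball_vol DIM('a)) * (\<integral>\<^sup>+ z\<in>B. ennreal (f z ^ DIM('a)) \<partial>\<mu>)"
    using l by (simp add: nn_integral_cmult ennreal_mult mult.assoc)
  finally show "emeasure N {(x, z). dist x y \<le> f z \<and> z \<in> B} =
      ennreal (l * unit_ball_vol DIM('a)) * (\<integral>\<^sup>+ z\<in>B. ennreal (f z ^ DIM('a)) \<partial>\<mu>)" .
qed

abbreviation cnt :: "('a \<times> real) set \<Rightarrow> 'w \<Rightarrow> ennreal" where "cnt A w \<equiv> num_points (\<omega> w) A"

lemma num_points_measurable [measurable]: "A \<in> sets borel \<Longrightarrow> (\<lambda>w. num_points (\<omega> w) A) \<in> borel_measurable M"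
  using ppp by (simp add: poisson_point_process_def sets_N)

lemma num_points_eq_0: "num_points \<xi> A = 0 \<longleftrightarrow> \<xi> \<inter> A = {}"
  by (auto simp: num_points_def emeasure_count_space)

lemma prob_num_points:
  assumes "A \<in> sets borel" "emeasure N A < \<infinity>"
  shows "\<P>(w in M. cnt A w = of_nat k) = measure N A ^ k / fact k * exp (- measure N A)"
  using ppp assms unfolding poisson_point_process_def sets_N by blast

lemma prob_empty:
  assumes "A \<in> sets borel" "emeasure N A < \<infinity>"
  shows "\<P>(w in M. cnt A w = 0) = exp (- measure N A)"
  using prob_num_points[OF assms, of 0] by simp

lemma prob_nonempty_le:
  assumes [measurable]: "A \<in> sets borel" and "emeasure N A < \<infinity>"
  shows "\<P>(w in M. cnt A w \<noteq> 0) \<le> measure N A"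
proof -
  have "\<P>(w in M. cnt A w \<noteq> 0) = 1 - \<P>(w in M. cnt A w = 0)"
    by (rule M.prob_neg) measurable
  then show ?thesis using prob_empty[OF assms] exp_ge_add_one_self[of "- measure N A"] by linarith
qed

text \<open>
  The Poisson weights add up to one, so no mass is left for an infinite number of points.
\<close>
lemma AE_num_points_finite:
  assumes [measurable]: "A \<in> sets borel" and "emeasure N A < \<infinity>"
  shows "AE w in M. cnt A w < \<infinity>"
proof -
  let ?a = "measure N A"
  let ?E = "\<lambda>k. {w \<in> space M. cnt A w = of_nat k}"
  have "(\<lambda>k. ?a ^ k / fact k) sums exp ?a" using exp_converges[of ?a] by (simp add: divide_inverse mult.commute)
  then have "(\<lambda>k. ?a ^ k / fact k * exp (- ?a)) sums (exp ?a * exp (- ?a))" by (rule sums_mult2)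
  then have s: "(\<lambda>k. ?a ^ k / fact k * exp (- ?a)) sums 1" by (simp flip: exp_add)
  have "(\<lambda>k. M.prob (?E k)) sums M.prob (\<Union>k. ?E k)"
    by (rule M.finite_measure_UNION) (auto simp: disjoint_family_on_def)
  then have "M.prob (\<Union>k. ?E k) = 1"
    using s sums_unique2 by (simp add: prob_num_points[OF assms])
  then have "AE w in M. w \<in> (\<Union>k. ?E k)" by (rule M.AE_prob_1)
  then show ?thesis by eventually_elim (auto simp: of_nat_less_top)
qed

text \<open>
  A countable family is enumerated by natural numbers; indices outside the range of the enumeration
  get the empty cell.
\<close>
lemma indep_cells:
  assumes I: "countable I" and C: "\<And>i. i \<in> I \<Longrightarrow> C i \<in> sets borel" "disjoint_family_on C I"
  shows "M.indep_vars (\<lambda>_. borel) (\<lambda>i. cnt (C i)) I"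
proof -
  define A where "A n = (if n \<in> to_nat_on I ` I then C (from_nat_into I n) else {})" for n
  have "range A \<subseteq> sets N" using C(1) I by (auto simp: A_def sets_N)
  moreover have "disjoint_family A"
    unfolding disjoint_family_on_def
  proof (intro ballI impI)
    fix m n :: nat assume "m \<noteq> n"
    show "A m \<inter> A n = {}"
    proof (cases "m \<in> to_nat_on I ` I \<and> n \<in> to_nat_on I ` I")
      case True
      then obtain i j where ij: "i \<in> I" "j \<in> I" "m = to_nat_on I i" "n = to_nat_on I j" by auto
      then have "i \<noteq> j" using \<open>m \<noteq> n\<close> by auto
      then show ?thesis using C(2) ij I by (auto simp: A_def disjoint_family_on_def)
    qed (auto simp: A_def)
  qed
  ultimately have "M.indep_vars (\<lambda>_. borel) (\<lambda>i. cnt (A i)) UNIV"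
    using ppp unfolding poisson_point_process_def by blast
  then have "M.indep_vars (\<lambda>_. borel) (\<lambda>i. cnt (A i)) (to_nat_on I ` I)"
    by (rule M.indep_vars_subset) auto
  then have "M.indep_vars (\<lambda>_. borel) (\<lambda>i. cnt (A (to_nat_on I i))) I"
    using M.indep_vars_reindex[OF inj_on_to_nat_on[OF I], of "\<lambda>_. borel" "\<lambda>n. cnt (A n)"] by simp
  then show ?thesis
    by (rule M.indep_vars_cong[THEN iffD1, rotated -1]) (auto simp: A_def I)
qed

lemma indep_cells_bool:
  assumes "countable I" "\<And>i. i \<in> I \<Longrightarrow> C i \<in> sets borel" "disjoint_family_on C I"
    and [measurable]: "Measurable.pred borel h"
  shows "M.indep_vars (\<lambda>_. count_space UNIV) (\<lambda>i w. h (cnt (C i) w)) I"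
  by (rule M.indep_vars_compose2[OF indep_cells[OF assms(1-3)]]) measurable

text \<open>
  Disjoint cells inside \<open>B\<close> have total intensity at most that of \<open>B\<close>. This bounds sums over lattice cells
  by volumes, without counting lattice points.
\<close>
lemma sum_prob_nonempty_le:
  assumes J: "finite J" and C: "\<And>i. i \<in> J \<Longrightarrow> C i \<in> sets borel" "disjoint_family_on C J"
    and B: "B \<in> sets borel" "emeasure N B < \<infinity>" and sub: "\<And>i. i \<in> J \<Longrightarrow> C i \<subseteq> B"
  shows "(\<Sum>i\<in>J. measure N (C i)) \<le> measure N B"
    and "(\<Sum>i\<in>J. \<P>(w in M. cnt (C i) w \<noteq> 0)) \<le> measure N B"
proof -
  have fin: "emeasure N (C i) < \<infinity>" if "i \<in> J" for i
    using emeasure_mono[OF sub[OF that], of N] B by (auto simp: sets_N intro: le_less_trans)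
  have "(\<Sum>i\<in>J. measure N (C i)) = measure N (\<Union>i\<in>J. C i)"
    using J C fin by (intro measure_finite_Union[symmetric]) (auto simp: sets_N less_top)
  also have "\<dots> \<le> measure N B"
    using B sub C(1) J by (intro measure_mono_fmeasurable) (auto simp: sets_N fmeasurable_def)
  finally show 1: "(\<Sum>i\<in>J. measure N (C i)) \<le> measure N B" .
  have "(\<Sum>i\<in>J. \<P>(w in M. cnt (C i) w \<noteq> 0)) \<le> (\<Sum>i\<in>J. measure N (C i))"
    using C fin by (intro sum_mono prob_nonempty_le) auto
  with 1 show "(\<Sum>i\<in>J. \<P>(w in M. cnt (C i) w \<noteq> 0)) \<le> measure N B" by simp
qed

end

section \<open>Measurability of vacant percolation\<close>

context boolean_model
begin

text \<open>
  Rounding enlarges radii by a bounded amount only, which preserves the moment.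
\<close>
lemma shifted_moment:
  assumes "0 \<le> a"
  shows "(\<integral>\<^sup>+ z. ennreal ((max 0 z + a) ^ DIM('a)) \<partial>\<mu>) < \<infinity>"
proof -
  have "(\<integral>\<^sup>+ z. ennreal ((max 0 z + a) ^ DIM('a)) \<partial>\<mu>)
      \<le> (\<integral>\<^sup>+ z. ennreal (2 ^ DIM('a)) * (ennreal (z ^ DIM('a)) + ennreal (a ^ DIM('a))) \<partial>\<mu>)"
  proof (rule nn_integral_mono_AE)
    show "AE z in \<mu>. ennreal ((max 0 z + a) ^ DIM('a))
        \<le> ennreal (2 ^ DIM('a)) * (ennreal (z ^ DIM('a)) + ennreal (a ^ DIM('a)))"
      using radius_nonneg
    proof eventually_elim
      case (elim z)
      have "(z + a) ^ DIM('a) \<le> (2 * max z a) ^ DIM('a)" using elim assms by (intro power_mono) auto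
      also have "\<dots> \<le> 2 ^ DIM('a) * (z ^ DIM('a) + a ^ DIM('a))"
        using elim assms by (auto simp: max_def power_mult_distrib)
      finally show ?case using elim assms by (simp flip: ennreal_mult ennreal_plus)
    qed
  qed
  also have "\<dots> = ennreal (2 ^ DIM('a)) * ((\<integral>\<^sup>+ z. ennreal (z ^ DIM('a)) \<partial>\<mu>) + ennreal (a ^ DIM('a)))"
    by (simp add: nn_integral_cmult nn_integral_add mu.emeasure_space_1)
  also have "\<dots> < \<infinity>" using moment by (simp add: ennreal_mult_less_top)
  finally show ?thesis .
qed

text \<open>
  For nonnegative \<open>z\<close> these are the balls that meet \<open>cball 0 r\<close>. Negative \<open>z\<close>, which form a null set,
  are treated like \<open>z = 0\<close> to keep the distance bound nonnegative.
\<close>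
definition touching :: "real \<Rightarrow> ('a \<times> real) set" where
  "touching r = {(x, z). dist x 0 \<le> max 0 z + r \<and> z \<in> UNIV}"

lemma touching_finite:
  assumes "0 \<le> r"
  shows "touching r \<in> sets borel" "emeasure N (touching r) < \<infinity>"
proof -
  have m: "(\<lambda>z. max 0 z + r) \<in> borel_measurable borel" by measurable
  show "touching r \<in> sets borel"
    unfolding touching_def by (rule emeasure_N_balls(1)[OF m]) (use assms in auto)
  have "emeasure N (touching r) = ennreal (l * unit_ball_vol DIM('a)) * (\<integral>\<^sup>+ z. ennreal ((max 0 z + r) ^ DIM('a)) \<partial>\<mu>)"
    unfolding touching_def using assms by (subst emeasure_N_balls(2)[OF m]) auto
  then show "emeasure N (touching r) < \<infinity>" using shifted_moment[OF assms] by (simp add: ennreal_mult_less_top)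
qed

lemma AE_locally_finite: "AE w in M. \<forall>n::nat. cnt (touching n) w < \<infinity>"
  unfolding AE_all_countable using AE_num_points_finite touching_finite by auto

text \<open>
  A locally finite union of closed balls is closed.
\<close>
lemma open_vacant_set:
  assumes "\<And>n::nat. num_points \<xi> (touching n) < \<infinity>"
  shows "open (vacant_set \<xi>)"
proof -
  have "closed (\<Union>i\<in>\<xi>. cball (fst i) (snd i))"
  proof (rule closed_Union_locally_finite_cballs)
    fix r
    obtain n :: nat where n: "r \<le> real n" using real_arch_simple by blast
    have "{i \<in> \<xi>. cball (fst i) (snd i) \<inter> cball 0 r \<noteq> {}} \<subseteq> \<xi> \<inter> touching n"
    proof
      fix i assume "i \<in> {i \<in> \<xi>. cball (fst i) (snd i) \<inter> cball 0 r \<noteq> {}}"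
      then obtain y where y: "i \<in> \<xi>" "dist (fst i) y \<le> snd i" "norm y \<le> r" by auto
      have "dist (fst i) 0 \<le> dist (fst i) y + dist y 0" by (rule dist_triangle)
      then have "norm (fst i) \<le> max 0 (snd i) + n" using y n by simp
      then show "i \<in> \<xi> \<inter> touching n" using y by (auto simp: touching_def case_prod_unfold)
    qed
    moreover have "finite (\<xi> \<inter> touching n)"
      using assms[of n] by (auto simp: num_points_def emeasure_count_space split: if_splits)
    ultimately show "finite {i \<in> \<xi>. cball (fst i) (snd i) \<inter> cball 0 r \<noteq> {}}" by (rule finite_subset)
  qed
  then show ?thesis by (simp only: vacant_set_def occupied_set_def case_prod_unfold open_Compl)
qed

text \<open>
  Almost surely the process is locally finite and the vacant set is open. Then
  \<open>unbounded_component_iff\<close> reduces percolation to countably many events of the form that no ball of the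
  process meets a given finite union of balls, and such an event says that the process has no point in
  a certain Borel set.
\<close>
lemma vacant_to_infinity_measurable:
  "{w \<in> space (completion M). vacant_to_infinity (\<omega> w)} \<in> sets (completion M)"
proof -
  obtain Q :: "('a \<times> real) set" where Q: "countable Q" "\<And>i. i \<in> Q \<Longrightarrow> 0 < snd i"
    "\<And>V x. open V \<Longrightarrow> x \<in> V \<Longrightarrow> \<exists>i\<in>Q. x \<in> ball (fst i) (snd i) \<and> cball (fst i) (snd i) \<subseteq> V"
    using countable_ball_basis by blast
  define K where "K T = (\<Union>i\<in>T. cball (fst i) (snd i))" for T :: "('a \<times> real) set"
  \<comment> \<open>the balls meeting \<open>K T\<close>; the constraint on \<open>z\<close> excludes the empty balls of negative radius\<close>
  define hit where "hit T = (\<Union>i\<in>T. {(x, z). dist x (fst i) \<le> z + snd i \<and> z \<in> {0..}})" for T :: "('a \<times> real) set"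
  define TT where "TT n = {T. finite T \<and> T \<subseteq> Q \<and> connected (K T) \<and> 0 \<in> K T \<and> (\<exists>y\<in>K T. real n \<le> norm y)}" for n
  have hit: "K T \<subseteq> vacant_set \<xi> \<longleftrightarrow> num_points \<xi> (hit T) = 0" if T: "T \<subseteq> Q" for T \<xi>
  proof -
    have meets: "(x, z) \<in> hit T \<longleftrightarrow> cball x z \<inter> K T \<noteq> {}" for x z
    proof
      assume "(x, z) \<in> hit T"
      then obtain i where i: "i \<in> T" "dist x (fst i) \<le> z + snd i" "0 \<le> z" by (auto simp: hit_def)
      then have "0 \<le> snd i" using Q(2)[of i] T by auto
      from cball_Int_cball_nonempty[OF i(3) this i(2)] show "cball x z \<inter> K T \<noteq> {}"
        using i by (auto simp: K_def)
    next
      assume "cball x z \<inter> K T \<noteq> {}"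
      then obtain i y where i: "i \<in> T" "dist x y \<le> z" "dist (fst i) y \<le> snd i" by (auto simp: K_def)
      have "0 \<le> dist x y" by simp
      then have "0 \<le> z" using i by linarith
      moreover have "dist x (fst i) \<le> z + snd i" using dist_triangle2[of x "fst i" y] i by simp
      ultimately show "(x, z) \<in> hit T" using i by (auto simp: hit_def)
    qed
    have "K T \<subseteq> vacant_set \<xi> \<longleftrightarrow> (\<forall>(x, z)\<in>\<xi>. cball x z \<inter> K T = {})"
      by (auto simp: vacant_set_def occupied_set_def)
    also have "\<dots> \<longleftrightarrow> \<xi> \<inter> hit T = {}" using meets by (auto simp: disjoint_iff)
    finally show ?thesis by (simp add: num_points_eq_0)
  qed
  define W where "W = {w \<in> space M. \<forall>n. \<exists>T\<in>TT n. cnt (hit T) w = 0}"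
  have TTc: "countable (TT n)" for n
    using countable_Collect_finite_subset[OF Q(1)] by (rule countable_subset[rotated]) (auto simp: TT_def)
  have hit_sets: "hit T \<in> sets borel" if "T \<in> TT n" for T n
  proof -
    have T: "finite T" "T \<subseteq> Q" using that by (auto simp: TT_def)
    show ?thesis unfolding hit_def
    proof (intro sets.finite_UN T(1) emeasure_N_balls(1))
      fix i z assume "i \<in> T" "z \<in> {0::real..}"
      then show "0 \<le> z + snd i" using Q(2)[of i] T(2) by fastforce
    qed auto
  qed
  have "{w \<in> space M. \<exists>T\<in>TT n. cnt (hit T) w = 0} \<in> sets M" for n
  proof (rule sets.sets_Collect_countable_Ex'[OF _ TTc])
    fix T assume "T \<in> TT n"
    note [measurable] = hit_sets[OF this]
    show "{w \<in> space M. cnt (hit T) w = 0} \<in> sets M" by measurable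
  qed
  then have W: "W \<in> sets M" unfolding W_def by (rule sets.sets_Collect_countable_All)
  \<comment> \<open>outside the null set \<open>Z\<close> the process is locally finite\<close>
  obtain Z where Z: "{w \<in> space M. \<not> (\<forall>n::nat. cnt (touching n) w < \<infinity>)} \<subseteq> Z" "Z \<in> null_sets M"
    using AE_locally_finite by (auto elim!: AE_E simp: null_sets_def)
  have eq: "vacant_to_infinity (\<omega> w) \<longleftrightarrow> w \<in> W" if "w \<in> space M" "w \<notin> Z" for w
  proof -
    have op: "open (vacant_set (\<omega> w))" using that Z by (intro open_vacant_set) auto
    have "vacant_to_infinity (\<omega> w) \<longleftrightarrow> (\<forall>n::nat. \<exists>T. finite T \<and> T \<subseteq> Q \<and> connected (K T) \<and> 0 \<in> K T \<and>
        (\<exists>y\<in>K T. real n \<le> norm y) \<and> K T \<subseteq> vacant_set (\<omega> w))"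
      using unbounded_component_iff[OF Q(3)[OF op] op] by (simp only: vacant_to_infinity_def K_def)
    also have "\<dots> \<longleftrightarrow> (\<forall>n. \<exists>T\<in>TT n. K T \<subseteq> vacant_set (\<omega> w))"
      by (simp add: TT_def Bex_def conj_assoc)
    also have "\<dots> \<longleftrightarrow> (\<forall>n. \<exists>T\<in>TT n. cnt (hit T) w = 0)"
    proof (intro all_cong1 bex_cong refl)
      fix n T assume "T \<in> TT n"
      then have "T \<subseteq> Q" by (simp add: TT_def)
      then show "K T \<subseteq> vacant_set (\<omega> w) \<longleftrightarrow> cnt (hit T) w = 0" by (rule hit)
    qed
    finally show ?thesis using that by (simp add: W_def)
  qed
  have "{w \<in> space (completion M). vacant_to_infinity (\<omega> w)} =
      (W - Z) \<union> {w \<in> space M. vacant_to_infinity (\<omega> w) \<and> w \<in> Z}"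
  proof (rule set_eqI)
    fix w
    show "w \<in> {w \<in> space (completion M). vacant_to_infinity (\<omega> w)} \<longleftrightarrow>
        w \<in> (W - Z) \<union> {w \<in> space M. vacant_to_infinity (\<omega> w) \<and> w \<in> Z}"
      using eq[of w] by (cases "w \<in> Z"; cases "w \<in> space M") (simp_all add: W_def)
  qed
  moreover have "{w \<in> space M. vacant_to_infinity (\<omega> w) \<and> w \<in> Z} \<subseteq> Z" by blast
  moreover have "W - Z \<in> sets M" using W Z(2) by (simp add: null_setsD2 sets.Diff)
  ultimately show ?thesis by (rule sets_completionI[OF _ _ Z(2)])
qed

end

section \<open>Percolation at small intensity\<close>

context boolean_model
begin

text \<open>
  The radius rounded up, plus an allowance: rounding the centre to the integer lattice moves it by at
  most \<open>DIM('a)\<close>, and a further unit separates the closed ball that contains the original one from the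
  open ball that is used in chains.
\<close>
definition coarse_radius :: "real \<Rightarrow> real" where
  "coarse_radius z = of_int \<lceil>max 0 z\<rceil> + real DIM('a) + 1"

lemma coarse_radius_bounds:
  "max 0 z + real DIM('a) + 1 \<le> coarse_radius z" "coarse_radius z \<le> max 0 z + (real DIM('a) + 2)"
  "1 \<le> coarse_radius z" "real DIM('a) \<le> coarse_radius z"
  unfolding coarse_radius_def by linarith+

lemma coarse_radius_measurable [measurable]: "coarse_radius \<in> borel_measurable borel"
  unfolding coarse_radius_def[abs_def] by measurable

definition coarse :: "'a \<times> real \<Rightarrow> 'a \<times> real" where
  "coarse p = (lattice_point 1 (fst p), coarse_radius (snd p))"

lemma coarse_measurable [measurable]: "coarse \<in> borel_measurable borel"
proof -
  have "coarse \<in> borel_measurable (borel \<Otimes>\<^sub>M borel)" unfolding coarse_def[abs_def] by measurable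
  then show ?thesis by (simp only: borel_prod)
qed

lemma cball_subset_coarse: "cball x z \<subseteq> cball (fst (coarse (x, z))) (snd (coarse (x, z)) - 1)"
proof
  fix y assume y: "y \<in> cball x z"
  have "dist x (lattice_point 1 x) \<le> DIM('a)" using dist_lattice_point[of 1 x] by simp
  then show "y \<in> cball (fst (coarse (x, z))) (snd (coarse (x, z)) - 1)"
    using y coarse_radius_bounds(1)[of z] dist_triangle3[of "lattice_point 1 x" y x]
    by (simp add: coarse_def)
qed

lemma finite_coarse: "finite {i \<in> range coarse. dist (fst i) y \<le> r \<and> snd i \<le> s}"
proof -
  have "{i \<in> range coarse. dist (fst i) y \<le> r \<and> snd i \<le> s} \<subseteq>
      {c \<in> range (lattice_point 1). dist c y \<le> r} \<times> ((\<lambda>n. of_int n + real DIM('a) + 1) ` {0..\<lfloor>s\<rfloor>})"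
  proof
    fix i assume "i \<in> {i \<in> range coarse. dist (fst i) y \<le> r \<and> snd i \<le> s}"
    then obtain p where p: "i = coarse p" "dist (fst i) y \<le> r" "snd i \<le> s" by auto
    have "\<lceil>max 0 (snd p)\<rceil> \<le> \<lfloor>s\<rfloor>" using p by (simp add: coarse_def coarse_radius_def le_floor_iff)
    moreover have "0 \<le> \<lceil>max 0 (snd p)\<rceil>" by simp
    ultimately have "snd i \<in> (\<lambda>n. of_int n + real DIM('a) + 1) ` {0..\<lfloor>s\<rfloor>}"
      unfolding p coarse_def coarse_radius_def snd_conv by (intro imageI) auto
    moreover have "fst i \<in> {c \<in> range (lattice_point 1). dist c y \<le> r}" using p by (auto simp: coarse_def)
    ultimately show "i \<in> {c \<in> range (lattice_point 1). dist c y \<le> r} \<times> ((\<lambda>n. of_int n + real DIM('a) + 1) ` {0..\<lfloor>s\<rfloor>})"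
      by (simp add: mem_Times_iff)
  qed
  then show ?thesis by (rule finite_subset) (intro finite_cartesian_product finite_lattice_points finite_imageI, auto)
qed

lemma countable_coarse: "countable (range coarse)"
proof -
  have "range coarse \<subseteq> range (lattice_point 1) \<times> (\<lambda>n. of_int n + real DIM('a) + 1) ` (UNIV :: int set)"
    by (auto simp: coarse_def coarse_radius_def)
  then show ?thesis by (rule countable_subset) (intro countable_SIGMA countable_lattice countable_image countableI_type, simp)
qed

text \<open>
  The radius distribution weighted by the volume of the rounded ball, up to a constant. It is finite
  because of the moment condition, and measures the intensity of balls in a window proportional
  to their radius.
\<close>
definition radius_mass :: "real measure" where
  "radius_mass = density \<mu> (\<lambda>z. ennreal (coarse_radius z ^ DIM('a)))"

text \<open>
  An upper bound for the total \<open>radius_mass\<close> that involves only \<open>\<mu>\<close> and the dimension, so that an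
  intensity can be chosen after it.
\<close>
definition moment_bound :: real where
  "moment_bound = enn2real (\<integral>\<^sup>+ z. ennreal ((max 0 z + (real DIM('a) + 2)) ^ DIM('a)) \<partial>\<mu>)"

lemma finite_radius_mass: "finite_measure radius_mass" "measure radius_mass B \<le> moment_bound"
proof -
  let ?m = "\<integral>\<^sup>+ z. ennreal ((max 0 z + (real DIM('a) + 2)) ^ DIM('a)) \<partial>\<mu>"
  have "emeasure radius_mass (space radius_mass) = (\<integral>\<^sup>+ z. ennreal (coarse_radius z ^ DIM('a)) \<partial>\<mu>)"
    unfolding radius_mass_def by (subst emeasure_density) (auto intro!: nn_integral_cong)
  also have "\<dots> \<le> ?m"
    using coarse_radius_bounds by (intro nn_integral_mono ennreal_leI power_mono) (auto intro: order_trans[of 0 1])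
  finally have le: "emeasure radius_mass (space radius_mass) \<le> ?m" .
  have fin: "?m < \<infinity>" using shifted_moment[of "real DIM('a) + 2"] by simp
  show fm: "finite_measure radius_mass" using le_less_trans[OF le fin] by (intro finite_measureI) simp
  then interpret finite_measure radius_mass .
  have "measure radius_mass B \<le> measure radius_mass (space radius_mass)" by (rule bounded_measure)
  also have "\<dots> \<le> moment_bound"
    unfolding moment_bound_def measure_def using le fin by (intro enn2real_mono) auto
  finally show "measure radius_mass B \<le> moment_bound" .
qed

lemma measure_N_coarse_balls:
  assumes B: "B \<in> sets borel" and t: "0 \<le> t"
  shows "{(x, z). dist x y \<le> t * coarse_radius z \<and> z \<in> B} \<in> sets borel" (is "?A \<in> _")
    and "emeasure N {(x, z). dist x y \<le> t * coarse_radius z \<and> z \<in> B} < \<infinity>"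
    and "measure N {(x, z). dist x y \<le> t * coarse_radius z \<and> z \<in> B} =
      l * unit_ball_vol DIM('a) * t ^ DIM('a) * measure radius_mass B"
proof -
  interpret rm: finite_measure radius_mass by (rule finite_radius_mass(1))
  have m: "(\<lambda>z. t * coarse_radius z) \<in> borel_measurable borel" by measurable
  have nn: "0 \<le> t * coarse_radius z" for z using t coarse_radius_bounds(3)[of z] by simp
  show "?A \<in> sets borel" by (rule emeasure_N_balls(1)[OF m B nn])
  have "emeasure N ?A = ennreal (l * unit_ball_vol DIM('a)) * (\<integral>\<^sup>+ z\<in>B. ennreal ((t * coarse_radius z) ^ DIM('a)) \<partial>\<mu>)"
    by (rule emeasure_N_balls(2)[OF m B nn])
  also have "(\<integral>\<^sup>+ z\<in>B. ennreal ((t * coarse_radius z) ^ DIM('a)) \<partial>\<mu>)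
      = (\<integral>\<^sup>+ z. ennreal (t ^ DIM('a)) * (ennreal (coarse_radius z ^ DIM('a)) * indicator B z) \<partial>\<mu>)"
    using t coarse_radius_bounds(3)
    by (intro nn_integral_cong) (auto simp: power_mult_distrib ennreal_mult' split: split_indicator)
  also have "\<dots> = ennreal (t ^ DIM('a)) * emeasure radius_mass B"
    using B unfolding radius_mass_def
    by (subst nn_integral_cmult) (auto simp: emeasure_density sets_mu)
  also have "emeasure radius_mass B = ennreal (measure radius_mass B)" by (rule rm.emeasure_eq_measure)
  finally have e: "emeasure N ?A = ennreal (l * unit_ball_vol DIM('a) * t ^ DIM('a) * measure radius_mass B)"
    using t l by (simp add: ennreal_mult mult.assoc)
  then show "emeasure N ?A < \<infinity>" by simp
  show "measure N ?A = l * unit_ball_vol DIM('a) * t ^ DIM('a) * measure radius_mass B"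
    using e t l by (simp add: measure_def)
qed

text \<open>
  The origin percolates in the vacant set outside two bad events: some ball is large relative to the
  distance of its centre from the origin, or there is a crossing at one of the points
  \<open>9 ^ k *\<^sub>R f\<close> and scale \<open>9 ^ k\<close>. Their probabilities are bounded by the two terms in the second
  smallness condition.
\<close>
lemma vacant_percolation_probable:
  fixes F :: "'a set" and q :: real
  assumes dim: "2 \<le> DIM('a)"
    and F: "finite F" "cball 0 144 \<subseteq> (\<Union>f\<in>F. cball f 1)"
    and q: "q = l * unit_ball_vol DIM('a) * moment_bound"
    and small: "2 * (card F)\<^sup>2 * (q * 55 ^ DIM('a)) \<le> 1"
      "q * 1001 ^ DIM('a) + 2 * card F * (q * 55 ^ DIM('a)) < 1"
  shows "0 < \<P>(w in completion M. vacant_to_infinity (\<omega> w))"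
proof -
  interpret rm: finite_measure radius_mass by (rule finite_radius_mass(1))
  have sets_rm [simp]: "sets radius_mass = sets borel" by (simp add: radius_mass_def sets_mu)
  let ?I = "range coarse"
  let ?C = "\<lambda>i. coarse -` {i}"
  let ?X = "\<lambda>i w. cnt (?C i) w \<noteq> 0"
  define S where "S w = {i \<in> ?I. ?X i w}" for w
  have C: "?C i \<in> sets borel" for i using measurable_sets[OF coarse_measurable, of "{i}"] by simp
  have disj: "disjoint_family_on ?C J" for J by (auto simp: disjoint_family_on_def)
  have ind: "M.indep_vars (\<lambda>_. count_space UNIV) ?X ?I"
    by (rule indep_cells_bool[OF countable_coarse C disj]) measurable
  have near_fin: "finite (near ?I y R)" for y R
    unfolding near_def by (rule finite_coarse)
  \<comment> \<open>the radii that are charged at scale \<open>9 ^ Suc k\<close>\<close>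
  define B where "B k = {z. 9 ^ k / 2 < coarse_radius z \<and> coarse_radius z \<le> 9 ^ Suc k / 2}" for k :: nat
  have B [measurable]: "B k \<in> sets borel" for k unfolding B_def by measurable
  have Bdisj: "disjoint_family B"
    unfolding disjoint_family_on_def
  proof (intro ballI impI)
    fix m n :: nat assume "m \<noteq> n"
    moreover have False if "m < n" "z \<in> B m" "z \<in> B n" for m n z
    proof -
      have "(9::real) ^ Suc m \<le> 9 ^ n" using that by (intro power_increasing) auto
      then show False using that by (auto simp: B_def)
    qed
    ultimately show "B m \<inter> B n = {}" by (metis disjoint_iff linorder_neqE_nat)
  qed
  define c where "c = l * unit_ball_vol DIM('a) * 55 ^ DIM('a)"
  have c: "0 \<le> c" using l by (simp add: c_def)
  \<comment> \<open>rounded radii are at least 1, so no ball is admissible at scale 1\<close>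
  define s where "s k = (case k of 0 \<Rightarrow> 0 | Suc k \<Rightarrow> c * measure radius_mass (B k))" for k
  have s_nonneg: "0 \<le> s k" for k using c by (simp add: s_def split: nat.split)
  have "(\<lambda>k. measure radius_mass (B k)) sums measure radius_mass (\<Union>k. B k)"
    by (rule rm.finite_measure_UNION) (use B Bdisj in auto)
  then have "(\<lambda>k. s (Suc k)) sums (c * measure radius_mass (\<Union>k. B k))"
    by (simp add: s_def sums_mult)
  then have s_sums: "s sums (c * measure radius_mass (\<Union>k. B k))"
    by (subst (asm) sums_Suc_iff) (simp add: s_def)
  have "c * measure radius_mass (\<Union>k. B k) \<le> c * moment_bound"
    using c by (intro mult_left_mono finite_radius_mass)
  also have "\<dots> = q * 55 ^ DIM('a)" by (simp add: c_def q)
  finally have s_le: "suminf s \<le> q * 55 ^ DIM('a)" using s_sums by (simp add: sums_iff)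
  have s_small: "2 * (card F)\<^sup>2 * suminf s \<le> 1"
  proof -
    have "2 * real ((card F)\<^sup>2) * suminf s \<le> 2 * real ((card F)\<^sup>2) * (q * 55 ^ DIM('a))"
      using s_le by (intro mult_left_mono) auto
    then show ?thesis using small(1) by simp
  qed
  have cross: "\<P>(w in M. crossing (S w) y (1 * 9 ^ k)) \<le> scale_bound s k" for y k
    unfolding S_def
  proof (rule M.prob_crossing_le[OF ind near_fin F(1)])
    show "cball 0 27 \<subseteq> (\<Union>f\<in>F. cball f 1)"
      by (rule subset_trans[OF subset_cball F(2)]) simp
    show "(\<Sum>i\<in>near ?I y 1. M.prob {w \<in> space M. ?X i w}) \<le> s 0" for y
    proof -
      have "\<not> coarse_radius z \<le> 1 / 2" for z using coarse_radius_bounds(3)[of z] by linarith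
      then have "near ?I y 1 = {}" by (auto simp: near_def coarse_def)
      then show ?thesis by (simp add: s_def)
    qed
    fix y k
    let ?J = "{i \<in> near ?I y (1 * 9 ^ Suc k). 1 * 9 ^ k / 2 < snd i}"
    let ?A = "{(x, z). dist x y \<le> 55 * coarse_radius z \<and> z \<in> B k}"
    have "(\<Sum>i\<in>?J. M.prob {w \<in> space M. ?X i w}) \<le> measure N ?A"
    proof (rule sum_prob_nonempty_le(2))
      show "finite ?J" using near_fin by simp
      show "coarse -` {i} \<subseteq> ?A" if "i \<in> ?J" for i
      proof
        fix p assume "p \<in> coarse -` {i}"
        then have i: "i = coarse p" by simp
        let ?r = "coarse_radius (snd p)"
        have "dist (lattice_point 1 (fst p)) y \<le> 27 * 9 ^ k" "9 ^ k < 2 * ?r" "snd p \<in> B k"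
          using that by (auto simp: i coarse_def near_def B_def)
        moreover have "dist (fst p) (lattice_point 1 (fst p)) \<le> DIM('a)"
          using dist_lattice_point[of 1 "fst p"] by simp
        moreover have "dist (fst p) y \<le> dist (fst p) (lattice_point 1 (fst p)) + dist (lattice_point 1 (fst p)) y"
          by (rule dist_triangle)
        ultimately have "dist (fst p) y \<le> 55 * ?r" "snd p \<in> B k"
          using coarse_radius_bounds(4)[of "snd p"] by linarith+
        then show "p \<in> ?A" by (simp add: case_prod_unfold)
      qed
    qed (use C disj measure_N_coarse_balls[OF B, of 55] in auto)
    also have "\<dots> = s (Suc k)" by (simp add: measure_N_coarse_balls[OF B] s_def c_def)
    finally show "(\<Sum>i\<in>?J. M.prob {w \<in> space M. ?X i w}) \<le> s (Suc k)" .
  qed (use s_nonneg s_sums s_small in \<open>auto simp: sums_iff\<close>)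
  have cross_ev: "{w \<in> space M. crossing (S w) y R} \<in> sets M" for y R
    unfolding S_def using M.crossing_event[OF ind near_fin] .
  let ?A = "{(x, z). dist x (0 :: 'a) \<le> 1001 * coarse_radius z \<and> z \<in> UNIV}"
  have A: "?A \<in> sets borel" "emeasure N ?A < \<infinity>"
    using measure_N_coarse_balls(1,2)[of UNIV 1001 0] by simp_all
  have "measure N ?A = l * unit_ball_vol DIM('a) * 1001 ^ DIM('a) * measure radius_mass UNIV"
    by (rule measure_N_coarse_balls(3)) auto
  also have "\<dots> \<le> l * unit_ball_vol DIM('a) * 1001 ^ DIM('a) * moment_bound"
    using l by (intro mult_left_mono finite_radius_mass) auto
  finally have measure_A: "measure N ?A \<le> q * 1001 ^ DIM('a)" by (simp add: q mult_ac)
  \<comment> \<open>the constant 1001 leaves a factor 1000 after the centre has been rounded\<close>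
  let ?E1 = "{w \<in> space M. cnt ?A w \<noteq> 0}"
  let ?E2 = "\<lambda>k::nat. \<Union>f\<in>F. {w \<in> space M. crossing (S w) (9 ^ k *\<^sub>R f) (9 ^ k)}"
  have E1: "?E1 \<in> sets M" using A(1) by measurable
  have E2: "?E2 k \<in> sets M" for k using F cross_ev by (intro sets.finite_UN) auto
  have E2_le: "M.prob (?E2 k) \<le> card F * scale_bound s k" for k
  proof -
    have "M.prob (?E2 k) \<le> (\<Sum>f\<in>F. \<P>(w in M. crossing (S w) (9 ^ k *\<^sub>R f) (9 ^ k)))"
      using F cross_ev by (intro M.finite_measure_subadditive_finite) auto
    also have "\<dots> \<le> (\<Sum>f\<in>F. scale_bound s k)" using cross by (intro sum_mono) simp
    finally show ?thesis by simp
  qed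
  have sb: "summable (scale_bound s)" "suminf (scale_bound s) \<le> 2 * suminf s"
    using scale_bound_summable[OF s_nonneg sums_summable[OF s_sums]] by blast+
  have sumE2: "summable (\<lambda>k. M.prob (?E2 k))"
    by (rule summable_comparison_test'[OF summable_mult[OF sb(1), of "card F"]]) (use E2_le in auto)
  have "M.prob (\<Union>k. ?E2 k) \<le> (\<Sum>k. M.prob (?E2 k))"
    using E2 sumE2 by (intro M.finite_measure_subadditive_countably) auto
  also have "\<dots> \<le> (\<Sum>k. card F * scale_bound s k)"
    using E2_le sumE2 sb by (intro suminf_le summable_mult) auto
  also have "\<dots> = card F * suminf (scale_bound s)" using sb by (simp add: suminf_mult)
  also have "\<dots> \<le> card F * (2 * (q * 55 ^ DIM('a)))" using order_trans[OF sb(2) mult_left_mono[OF s_le]] by (intro mult_left_mono) auto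
  finally have pE2: "M.prob (\<Union>k. ?E2 k) \<le> 2 * card F * (q * 55 ^ DIM('a))" by simp
  have pE1: "M.prob ?E1 \<le> q * 1001 ^ DIM('a)" using prob_nonempty_le[OF A] measure_A by simp
  let ?bad = "?E1 \<union> (\<Union>k. ?E2 k)"
  have bad: "?bad \<in> sets M" using E1 E2 by blast
  have "M.prob ?bad \<le> M.prob ?E1 + M.prob (\<Union>k. ?E2 k)" using E1 E2 by (intro measure_Un_le) auto
  then have "M.prob ?bad < 1" using pE1 pE2 small(2) by simp
  then have pos: "0 < M.prob (space M - ?bad)" using M.prob_compl[OF bad] by simp
  have good: "vacant_to_infinity (\<omega> w)" if w: "w \<in> space M - ?bad" for w
  proof -
    have noA: "\<omega> w \<inter> ?A = {}" using w num_points_eq_0[of "\<omega> w" ?A] by auto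
    have Sp: "\<exists>p\<in>\<omega> w. i = coarse p" if "i \<in> S w" for i
    proof -
      have "\<omega> w \<inter> ?C i \<noteq> {}" using that by (simp add: S_def num_points_eq_0)
      then show ?thesis by blast
    qed
    have Sw: "1 \<le> snd i \<and> 1000 * snd i < norm (fst i)" if "i \<in> S w" for i
    proof -
      obtain p where p: "p \<in> \<omega> w" "i = coarse p" using Sp \<open>i \<in> S w\<close> by blast
      have "1001 * coarse_radius (snd p) < norm (fst p)"
        using noA p by (force simp: case_prod_unfold not_le)
      moreover have "norm (fst p) \<le> norm (lattice_point 1 (fst p)) + dist (fst p) (lattice_point 1 (fst p))"
        using norm_triangle_sub[of "fst p" "lattice_point 1 (fst p)"] by (simp add: dist_norm)
      ultimately show ?thesis
        using coarse_radius_bounds(3,4)[of "snd p"] dist_lattice_point[of 1 "fst p"] by (simp add: p coarse_def)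
    qed
    have fin: "finite {i \<in> S w. norm (fst i) \<le> r}" for r
    proof (rule finite_subset[OF _ finite_coarse[of 0 r r]])
      show "{i \<in> S w. norm (fst i) \<le> r} \<subseteq> {i \<in> ?I. dist (fst i) 0 \<le> r \<and> snd i \<le> r}"
      proof
        fix i assume "i \<in> {i \<in> S w. norm (fst i) \<le> r}"
        then show "i \<in> {i \<in> ?I. dist (fst i) 0 \<le> r \<and> snd i \<le> r}" using Sw[of i] by (auto simp: S_def)
      qed
    qed
    let ?V = "- (\<Union>i\<in>S w. cball (fst i) (snd i - 1))"
    have "\<not> bounded (connected_component_set ?V 0)"
    proof
      assume "bounded (connected_component_set ?V 0)"
      from crossing_of_bounded_vacant_component[OF dim F(2) Sw fin this] show False using w by auto
    qed
    moreover have "?V \<subseteq> vacant_set (\<omega> w)"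
    proof -
      have "cball (fst p) (snd p) \<subseteq> (\<Union>i\<in>S w. cball (fst i) (snd i - 1))" if p: "p \<in> \<omega> w" for p
      proof -
        have "cnt (?C (coarse p)) w \<noteq> 0" using p num_points_eq_0[of "\<omega> w" "?C (coarse p)"] by auto
        then have "coarse p \<in> S w" by (simp add: S_def)
        then show ?thesis using cball_subset_coarse[of "fst p" "snd p"] by auto
      qed
      then show ?thesis unfolding vacant_set_def occupied_set_def by (force simp: case_prod_unfold)
    qed
    then have "connected_component_set ?V 0 \<subseteq> connected_component_set (vacant_set (\<omega> w)) 0"
      by (rule connected_component_mono)
    ultimately show ?thesis unfolding vacant_to_infinity_def using bounded_subset by blast
  qed
  interpret CM: prob_space "completion M" by (rule M.prob_space_completion)
  have "M.prob (space M - ?bad) = measure (completion M) (space M - ?bad)"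
    using bad by (simp add: measure_completion)
  also have "\<dots> \<le> \<P>(w in completion M. vacant_to_infinity (\<omega> w))"
    using good vacant_to_infinity_measurable by (intro CM.finite_measure_mono) auto
  finally show ?thesis using pos by simp
qed

end

section \<open>Absence of percolation at large intensity\<close>

context boolean_model
begin

text \<open>
  Here the random balls mark the lattice cubes without a centre of radius at least \<open>\<epsilon>\<close>. All have radius
  \<open>2 * \<epsilon>\<close>, which is admissible already at the initial scale \<open>4 * \<epsilon>\<close>; so the only error term is the initial one,
  the expected number of such cubes in a window. The constant \<open>K\<close> bounds the number of cubes in the window by
  comparing volumes.
\<close>
lemma vacant_percolation_null:
  fixes F :: "'a set" and \<epsilon> :: real
  assumes F: "finite F" "cball 0 27 \<subseteq> (\<Union>f\<in>F. cball f 1)"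
    and e: "0 < \<epsilon>" and \<theta>: "\<theta> = measure \<mu> {\<epsilon>..}" "0 < \<theta>" and l0: "0 < l"
    and K: "K = unit_ball_vol DIM('a) * (13 * \<epsilon>) ^ DIM('a) / (\<epsilon> / DIM('a)) ^ DIM('a)"
    and small: "2 * (card F)\<^sup>2 * (K * exp (- l * ((\<epsilon> / DIM('a)) ^ DIM('a) * \<theta>))) \<le> 1"
  shows "\<P>(w in completion M. vacant_to_infinity (\<omega> w)) = 0"
proof -
  \<comment> \<open>cubes of this side have diameter at most \<open>\<epsilon>\<close>\<close>
  define \<delta> where "\<delta> = \<epsilon> / DIM('a)"
  have d: "0 < \<delta>" "DIM('a) * \<delta> = \<epsilon>" using e by (auto simp: \<delta>_def)
  define v where "v = l * (\<delta> ^ DIM('a) * \<theta>)"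
  have v: "0 < v" using d l0 \<theta> by (simp add: v_def)
  have K0: "0 \<le> K" using e by (simp add: K)
  let ?I = "range (lattice_point \<delta> :: 'a \<Rightarrow> 'a) \<times> {2 * \<epsilon>}"
  define C where "C i = {(x, z). lattice_point \<delta> x = fst i \<and> \<epsilon> \<le> z}" for i :: "'a \<times> real"
  let ?X = "\<lambda>i w. cnt (C i) w = 0"
  define S where "S w = {i \<in> ?I. ?X i w}" for w
  have C: "C i \<in> sets borel" for i
  proof -
    have "{p \<in> space (borel \<Otimes>\<^sub>M borel). lattice_point \<delta> (fst p) = fst i \<and> \<epsilon> \<le> snd p} \<in> sets (borel \<Otimes>\<^sub>M borel)"
      by measurable
    then show ?thesis unfolding borel_prod by (simp add: C_def case_prod_unfold)
  qed
  have disj: "disjoint_family_on C ?I" by (auto simp: disjoint_family_on_def C_def)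
  have "countable ?I" using countable_lattice[OF d(1)] by (intro countable_SIGMA) auto
  then have ind: "M.indep_vars (\<lambda>_. count_space UNIV) ?X ?I"
    by (rule indep_cells_bool[OF _ C disj]) measurable
  have near_fin: "finite (near ?I y R)" for y R
  proof -
    have "near ?I y R \<subseteq> {c \<in> range (lattice_point \<delta>). dist c y \<le> 3 * R} \<times> {2 * \<epsilon>}"
      by (auto simp: near_def)
    then show ?thesis using finite_lattice_points[OF d(1)] finite_subset by blast
  qed
  let ?big = "\<lambda>y. {(x, z). dist x y \<le> 13 * \<epsilon> \<and> z \<in> {\<epsilon>..}}"
  have big_sets: "?big y \<in> sets borel" for y :: 'a
    using e by (intro emeasure_N_balls(1)) auto
  have "emeasure N (?big y) = ennreal (l * unit_ball_vol DIM('a)) * (ennreal ((13 * \<epsilon>) ^ DIM('a)) * emeasure \<mu> {\<epsilon>..})" for y :: 'a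
    using e by (subst emeasure_N_balls(2)) (auto simp: nn_integral_cmult_indicator sets_mu)
  then have big: "emeasure N (?big y) = ennreal (l * unit_ball_vol DIM('a) * ((13 * \<epsilon>) ^ DIM('a) * \<theta>))" for y :: 'a
    using e l \<theta> by (simp add: mu.emeasure_eq_measure ennreal_mult)
  have sub: "C i \<subseteq> ?big y" if "dist (fst i) y \<le> 12 * \<epsilon>" for i y
  proof
    fix p assume "p \<in> C i"
    then have p: "lattice_point \<delta> (fst p) = fst i" "\<epsilon> \<le> snd p" by (auto simp: C_def)
    have "dist (fst p) (fst i) \<le> \<epsilon>" using dist_lattice_point[OF d(1), of "fst p"] p d by simp
    then show "p \<in> ?big y" using dist_triangle[of "fst p" y "fst i"] that p by (auto simp: case_prod_unfold)
  qed
  have finC: "emeasure N (C i) < \<infinity>" for i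
    using emeasure_mono[OF sub[of i "fst i"], of N] big big_sets e by (auto simp: sets_N intro: le_less_trans)
  have C_ge: "v \<le> measure N (C i)" if "i \<in> ?I" for i
  proof -
    have "ennreal v = ennreal l * (ennreal (\<delta> ^ DIM('a)) * emeasure \<mu> {\<epsilon>..})"
      using l d \<theta> by (simp add: v_def ennreal_mult mu.emeasure_eq_measure)
    also have "\<dots> \<le> ennreal l * (\<integral>\<^sup>+ z. emeasure lborel {x :: 'a. lattice_point \<delta> x = fst i} * indicator {\<epsilon>..} z \<partial>\<mu>)"
      using emeasure_lattice_cell_ge[OF d(1), of "fst i"] that
      by (subst nn_integral_cmult_indicator) (auto simp: sets_mu intro!: mult_left_mono mult_right_mono)
    also have "\<dots> = emeasure N (C i)"
      unfolding emeasure_N[OF C]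
      by (intro arg_cong2[where f = "(*)"] nn_integral_cong refl)
         (auto simp: C_def vimage_def split: split_indicator)
    finally have "ennreal v \<le> ennreal (measure N (C i))"
      using finC[of i] by (simp add: emeasure_eq_ennreal_measure)
    then show ?thesis by (simp add: ennreal_le_iff)
  qed
  define s where "s k = (if k = 0 then K * exp (- v) else 0)" for k :: nat
  have s_sums: "s sums (K * exp (- v))"
    using sums_finite[of "{0}" s] by (simp add: s_def)
  define R0 where "R0 = 4 * \<epsilon>"
  have R0: "0 < R0" using e by (simp add: R0_def)
  have cross: "\<P>(w in M. crossing (S w) y (R0 * 9 ^ k)) \<le> scale_bound s k" for y k
    unfolding S_def
  proof (rule M.prob_crossing_le[OF ind near_fin F R0])
    show "0 \<le> s k" for k using K0 by (simp add: s_def)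
    show "summable s" using s_sums by (simp add: sums_iff)
    show "2 * (card F)\<^sup>2 * suminf s \<le> 1" using small s_sums by (simp add: sums_iff v_def \<delta>_def)
    fix y
    let ?J = "near ?I y R0"
    have J: "dist (fst i) y \<le> 12 * \<epsilon>" "i \<in> ?I" if "i \<in> ?J" for i using that by (auto simp: near_def R0_def)
    have "card ?J * v = (\<Sum>i\<in>?J. v)" by simp
    also have "\<dots> \<le> (\<Sum>i\<in>?J. measure N (C i))" using C_ge J by (intro sum_mono) blast
    also have "\<dots> \<le> measure N (?big y)"
      using sub J near_fin C big_sets big
      by (intro sum_prob_nonempty_le(1)) (auto intro: disjoint_family_on_mono[OF _ disj])
    also have "\<dots> = l * unit_ball_vol DIM('a) * ((13 * \<epsilon>) ^ DIM('a) * \<theta>)"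
      using big e l \<theta> by (simp add: measure_def)
    also have "\<dots> = K * v"
      using d by (simp add: K v_def \<delta>_def[symmetric])
    finally have cardJ: "card ?J \<le> K" using v by simp
    have "(\<Sum>i\<in>?J. M.prob {w \<in> space M. ?X i w}) \<le> (\<Sum>i\<in>?J. exp (- v))"
      using prob_empty[OF C finC] C_ge J by (intro sum_mono) auto
    also have "\<dots> \<le> K * exp (- v)" using cardJ by simp
    finally show "(\<Sum>i\<in>?J. M.prob {w \<in> space M. ?X i w}) \<le> s 0" by (simp add: s_def)
    fix k
    have "(1::real) \<le> 9 ^ k" by simp
    then have "2 * \<epsilon> \<le> R0 * 9 ^ k / 2" using e by (simp add: R0_def)
    then have "{i \<in> near ?I y (R0 * 9 ^ Suc k). R0 * 9 ^ k / 2 < snd i} = {}"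
      by (auto simp: near_def)
    then show "(\<Sum>i\<in>{i \<in> near ?I y (R0 * 9 ^ Suc k). R0 * 9 ^ k / 2 < snd i}. M.prob {w \<in> space M. ?X i w}) \<le> s (Suc k)"
      by (simp only: s_def) simp
  qed
  have cross_of_vacant: "crossing (S w) 0 R" if inf: "vacant_to_infinity (\<omega> w)" and R: "4 * \<epsilon> \<le> R" for w R
  proof -
    let ?V = "vacant_set (\<omega> w)" 
    let ?U = "connected_component_set ?V 0"
    let ?i = "\<lambda>y. (lattice_point \<delta> y, 2 * \<epsilon>)"
    \<comment> \<open>a centre in the cube of \<open>y\<close> with radius at least \<open>\<epsilon>\<close> would cover \<open>y\<close>\<close>
    have vac: "?i y \<in> S w" if "y \<in> ?V" for y
    proof -
      have "\<omega> w \<inter> C (?i y) = {}"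
      proof (rule ccontr)
        assume "\<omega> w \<inter> C (?i y) \<noteq> {}"
        then obtain x z where xz: "(x, z) \<in> \<omega> w" "lattice_point \<delta> x = lattice_point \<delta> y" "\<epsilon> \<le> z"
          by (auto simp: C_def)
        then have "y \<in> cball x z" using dist_same_lattice_point[OF d(1) xz(2)] d by simp
        then show False using that xz by (auto simp: vacant_set_def occupied_set_def)
      qed
      then show ?thesis by (simp add: S_def num_points_eq_0)
    qed
    have ball: "y \<in> ball (fst (?i y)) (snd (?i y))" for y :: 'a
      using dist_lattice_point[OF d(1), of y] d e by (simp add: dist_commute)
    have unb: "\<not> bounded ?U" using inf by (simp add: vacant_to_infinity_def)
    then obtain q where q: "q \<in> ?U" "2 * R + \<epsilon> < norm q" by (auto simp: bounded_iff not_le)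
    have UV: "?U \<subseteq> ?V" by (rule connected_component_subset)
    have "0 \<in> ?U" using q by (metis connected_component_in connected_component_refl mem_Collect_eq)
    show ?thesis
    proof (rule crossing_of_chain)
      have "?U \<subseteq> (\<Union>k\<in>S w. ball (fst k) (snd k))"
      proof
        fix y assume "y \<in> ?U"
        then show "y \<in> (\<Union>k\<in>S w. ball (fst k) (snd k))" using UV vac ball[of y] by (intro UN_I[of "?i y"]) auto
      qed
      from chain_of_connected[OF connected_connected_component this \<open>0 \<in> ?U\<close> q(1)]
      show "(?i 0, ?i q) \<in> (links (S w))\<^sup>*"
        using vac[OF subsetD[OF UV \<open>0 \<in> ?U\<close>]] vac[OF subsetD[OF UV q(1)]] ball[of 0] ball[of q] by blast
      show "?i 0 \<in> S w" using \<open>0 \<in> ?U\<close> UV vac by blast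
      show "0 < R" using R e by simp
      show "dist (fst (?i 0)) 0 \<le> R" using R e by simp
      have "norm q \<le> dist q (lattice_point \<delta> q) + norm (lattice_point \<delta> q)"
        using norm_triangle_sub[of q "lattice_point \<delta> q"] by (simp add: dist_norm)
      then show "2 * R \<le> dist (fst (?i q)) 0" using q dist_lattice_point[OF d(1), of q] d by simp
      show "snd k \<le> R / 2" if "k \<in> S w" for k using that R by (auto simp: S_def)
      then show "snd j \<le> R / 2" if "(k, j) \<in> links (S w)" for k j using that by (auto simp: links_def)
    qed
  qed
  let ?E = "{w \<in> space (completion M). vacant_to_infinity (\<omega> w)}"
  interpret CM: prob_space "completion M" by (rule M.prob_space_completion)
  have "measure (completion M) ?E \<le> scale_bound s k" for k
  proof -
    let ?G = "{w \<in> space M. crossing (S w) 0 (R0 * 9 ^ k)}"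
    have G: "?G \<in> sets M" unfolding S_def by (rule M.crossing_event[OF ind near_fin])
    have "(1::real) \<le> 9 ^ k" by simp
    then have "4 * \<epsilon> \<le> R0 * 9 ^ k" using e by (simp add: R0_def)
    then have "measure (completion M) ?E \<le> measure (completion M) ?G"
      using G cross_of_vacant by (intro CM.finite_measure_mono) auto
    also have "\<dots> = M.prob ?G" using G by simp
    also have "\<dots> \<le> scale_bound s k" by (rule cross)
    finally show ?thesis .
  qed
  moreover have "scale_bound s \<longlonglongrightarrow> 0"
    using s_sums K0 by (intro summable_LIMSEQ_zero scale_bound_summable(1)) (auto simp: sums_iff s_def)
  ultimately have "measure (completion M) ?E \<le> 0"
    by (intro LIMSEQ_le_const[of "scale_bound s"]) auto
  then show ?thesis by (simp add: antisym)
qed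

end

section \<open>Nontriviality of the threshold\<close>

text \<open>
  If all tails vanished, the distribution would be concentrated at \<open>0\<close>.
\<close>
lemma positive_tail:
  fixes M :: "real measure"
  assumes "prob_space M" and s: "sets M = sets borel" and nn: "AE r in M. 0 \<le> r" and ne: "M \<noteq> return borel 0"
  obtains e where "0 < e" "0 < measure M {e..}"
proof (rule ccontr)
  interpret prob_space M by fact
  assume "\<not> thesis"
  then have z: "measure M {e..} = 0" if "0 < e" for e
    using that measure_nonneg[of M "{e..}"] by (metis less_eq_real_def \<open>\<And>e. \<lbrakk>0 < e; 0 < measure M {e..}\<rbrakk> \<Longrightarrow> thesis\<close>)
  have "AE r in M. r < 1 / Suc n" for n
  proof (rule AE_I[of _ _ "{1 / real (Suc n)..}"])
    show "emeasure M {1 / real (Suc n)..} = 0" using z[of "1 / real (Suc n)"] by (simp add: emeasure_eq_measure)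
    show "{1 / real (Suc n)..} \<in> sets M" by (simp add: s)
  qed auto
  then have "AE r in M. \<forall>n. r < 1 / Suc n" by (simp add: AE_all_countable)
  with nn have AE0: "AE r in M. r = 0"
  proof eventually_elim
    case (elim r)
    show "r = 0"
    proof (rule ccontr)
      assume "r \<noteq> 0"
      then have "0 < r" using elim by simp
      then obtain n where "1 / real (Suc n) < r" using nat_approx_posE by auto
      then show False using elim by (meson order_less_asym)
    qed
  qed
  have "M = return borel 0"
  proof (rule measure_eqI)
    fix A assume A: "A \<in> sets M"
    have "emeasure M A = (\<integral>\<^sup>+ r. indicator A r \<partial>M)" using A by simp
    also have "\<dots> = (\<integral>\<^sup>+ r. indicator A 0 \<partial>M)" using AE0 by (intro nn_integral_cong_AE) auto
    also have "\<dots> = indicator A 0" by (simp add: emeasure_space_1)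
    finally show "emeasure M A = emeasure (return borel 0) A" using A s by simp
  qed (simp add: s)
  then show False using ne by simp
qed

theorem theorem2:
  fixes \<mu> :: "real measure"
    and P :: "real \<Rightarrow> 'w measure"
    and \<omega> :: "'w \<Rightarrow> ('a::euclidean_space \<times> real) set"
  assumes "DIM('a) \<ge> 2"
    and "prob_space \<mu>" and "sets \<mu> = sets borel"
    and "AE r in \<mu>. 0 \<le> r" and "\<mu> \<noteq> return borel 0"
    and "(\<integral>\<^sup>+ r. ennreal (r ^ DIM('a)) \<partial>\<mu>) < \<infinity>"
    and "\<And>l. 0 \<le> l \<Longrightarrow> poisson_point_process (P l) \<omega> (boolean_intensity l \<mu>)"
  shows "0 < vacant_threshold P \<omega> \<and> vacant_threshold P \<omega> < \<infinity>"
proof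
  have model: "boolean_model \<mu> (P l) \<omega> l" if "0 \<le> l" for l
    using assms that by (simp add: boolean_model_def boolean_model_axioms_def)
  obtain F :: "'a set" where F: "finite F" "cball 0 144 \<subseteq> (\<Union>f\<in>F. cball f 1)"
    by (rule finite_unit_net)
  have F27: "cball 0 27 \<subseteq> (\<Union>f\<in>F. cball f 1)"
    by (rule subset_trans[OF subset_cball F(2)]) simp
  let ?n = "real ((card F)\<^sup>2)"
  let ?Thr = "{ereal l |l. 0 \<le> l \<and> \<P>(w in completion (P l). vacant_to_infinity (\<omega> w)) > 0}"
  show "0 < vacant_threshold P \<omega>"
  proof -
    define \<kappa> where "\<kappa> = unit_ball_vol DIM('a) *
      enn2real (\<integral>\<^sup>+ z. ennreal ((max 0 z + (real DIM('a) + 2)) ^ DIM('a)) \<partial>\<mu>)"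
    have \<kappa>: "0 \<le> \<kappa>" by (simp add: \<kappa>_def)
    define T where "T = 2 * ?n * 55 ^ DIM('a) + 1001 ^ DIM('a) + 2 * card F * 55 ^ DIM('a)"
    have T: "2 * ?n * 55 ^ DIM('a) \<le> T" "1001 ^ DIM('a) + 2 * card F * 55 ^ DIM('a) \<le> T" "0 \<le> T"
      by (simp_all add: T_def)
    \<comment> \<open>any \<open>l\<close> with \<open>l * \<kappa> * T < 1\<close> meets both smallness conditions\<close>
    define l where "l = 1 / (\<kappa> * T + 1)"
    have l_pos: "0 < l" using \<kappa> T by (simp add: l_def add_nonneg_pos)
    have lT: "l * \<kappa> * T < 1" using \<kappa> T by (simp add: l_def divide_less_eq add_nonneg_pos)
    have lk: "0 \<le> l * \<kappa>" using l_pos \<kappa> by simp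
    interpret boolean_model \<mu> "P l" \<omega> l using model l_pos by simp
    have "0 < \<P>(w in completion (P l). vacant_to_infinity (\<omega> w))"
    proof (rule vacant_percolation_probable[OF assms(1) F, of "l * \<kappa>"])
      show "l * \<kappa> = l * unit_ball_vol DIM('a) * moment_bound"
        by (simp add: \<kappa>_def moment_bound_def mult.assoc)
      have "2 * ?n * (l * \<kappa> * 55 ^ DIM('a)) = l * \<kappa> * (2 * ?n * 55 ^ DIM('a))" by (simp add: mult_ac)
      also have "\<dots> \<le> l * \<kappa> * T" using lk T by (intro mult_left_mono)
      finally show "2 * (card F)\<^sup>2 * (l * \<kappa> * 55 ^ DIM('a)) \<le> 1" using lT by simp
      have "l * \<kappa> * 1001 ^ DIM('a) + 2 * card F * (l * \<kappa> * 55 ^ DIM('a))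
          = l * \<kappa> * (1001 ^ DIM('a) + 2 * card F * 55 ^ DIM('a))" by (simp add: algebra_simps)
      also have "\<dots> \<le> l * \<kappa> * T" using lk T by (intro mult_left_mono)
      finally show "l * \<kappa> * 1001 ^ DIM('a) + 2 * card F * (l * \<kappa> * 55 ^ DIM('a)) < 1" using lT by simp
    qed
    then have "ereal l \<in> ?Thr" using l_pos by auto
    then have "ereal l \<le> vacant_threshold P \<omega>" unfolding vacant_threshold_def by (rule Sup_upper)
    then show ?thesis using l_pos by (meson ereal_less(2) less_le_trans)
  qed
  show "vacant_threshold P \<omega> < \<infinity>"
  proof -
    obtain \<epsilon> where e: "0 < \<epsilon>" "0 < measure \<mu> {\<epsilon>..}"
      using positive_tail assms by blast
    define K where "K = unit_ball_vol DIM('a) * (13 * \<epsilon>) ^ DIM('a) / (\<epsilon> / DIM('a)) ^ DIM('a)"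
    have K: "0 \<le> K" using e by (simp add: K_def)
    define v where "v = (\<epsilon> / DIM('a)) ^ DIM('a) * measure \<mu> {\<epsilon>..}"
    have v: "0 < v" using e by (simp add: v_def)
    \<comment> \<open>for \<open>l \<ge> l0\<close> the bound \<open>exp (l * v) \<ge> 1 + l * v\<close> yields the smallness condition\<close>
    define l0 where "l0 = 2 * ?n * K / v + 1"
    have l0: "0 < l0" using K v by (simp add: l0_def add_nonneg_pos)
    have null: "\<P>(w in completion (P l). vacant_to_infinity (\<omega> w)) = 0" if ge: "l0 \<le> l" for l
    proof -
      interpret boolean_model \<mu> "P l" \<omega> l using model ge l0 by simp
      have "2 * ?n * K \<le> l0 * v" using v by (simp add: l0_def field_simps)
      also have "\<dots> \<le> l * v" using ge v by (intro mult_right_mono) auto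
      also have "\<dots> \<le> exp (l * v)" using exp_ge_add_one_self[of "l * v"] by linarith
      finally have "2 * ?n * K * exp (- (l * v)) \<le> exp (l * v) * exp (- (l * v))"
        by (intro mult_right_mono) auto
      then have "2 * ?n * (K * exp (- l * v)) \<le> 1" by (simp add: exp_minus mult.assoc)
      then show ?thesis
        using ge l0 by (intro vacant_percolation_null[OF F(1) F27 e(1) refl e(2) _ K_def]) (auto simp: v_def)
    qed
    have "vacant_threshold P \<omega> \<le> ereal l0"
      unfolding vacant_threshold_def
    proof (rule Sup_least)
      fix x assume "x \<in> ?Thr"
      then obtain l where "x = ereal l" "\<P>(w in completion (P l). vacant_to_infinity (\<omega> w)) > 0" by auto
      then show "x \<le> ereal l0" using null[of l] by (cases "l0 \<le> l") auto
    qed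
    then show ?thesis using less_ereal.simps(4) le_less_trans by blast
  qed
qed

end
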